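(* Let $(V^{\mathrm{sym}},b^{\mathrm{sym}},m^{\mathrm{sym}})$ be a weakly spherically symmetric graph with associated Laplacian $L^{\mathrm{sym}}$. If $$\sum_{r=0}^\infty\frac{V_1(r)}{\partial B(r)}=a<\infty,$$ then $$\lambda_0(L^{\mathrm{sym}})\ge\frac1a\quad\text{and}\quad\sigma(L^{\mathrm{sym}})=\sigma_{\mathrm{disc}}(L^{\mathrm{sym}}).$$
   Context: A weighted graph $(V,b,m)$ (with zero potential) consists of a countably infinite set $V$, a map $m:V\to(0,\infty)$ (extended to a measure by $m(U)=\sum_{x\in U}m(x)$), and a symmetric map $b:V\times V\to[0,\infty)$ with zero diagonal. Write $x\sim y$ if $b(x,y)>0$. All weighted graphs are assumed connected (any two vertices are joined by a finite path of successive neighbors) and locally finite (each vertex has only finitely many neighbors). Let $d$ be the combinatorial graph metric. For a fixed vertex $x_0$ and $r\in\mathbb{N}_0=\{0,1,2,\dots\}$ put $S_r=\{x:d(x,x_0)=r\}$, $S_{-1}=\emptyset$, $B_r=\bigcup_{i=0}^rS_i$. For $x\in S_r$ let $\kappa_{\pm}(x)=\frac1{m(x)}\sum_{y\in S_{r\pm1}}b(x,y)$. The graph is weakly spherically symmetric with root $x_0$ if $\kappa_+$ and $\kappa_-$ depend only on $d(\cdot,x_0)$. With balls and spheres taken around the root, $V_1(r)=m(B_r)$ and $\partial B(r)=\sum_{x\in S_r}\kappa_+(x)m(x)$ ($=\kappa_+(r)m(S_r)$). On the real Hilbert space $\ell^2(V,m)$ with $\langle f,g\rangle=\sum_x f(x)g(x)m(x)$,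 let $Q(f,g)=\frac12\sum_{x,y}b(x,y)(f(x)-f(y))(g(x)-g(y))$ with domain $D(Q)$ equal to the closure of the finitely supported functions with respect to $\langle\cdot,\cdot\rangle+Q(\cdot,\cdot)$, and let $L$ be the associated non-negative selfadjoint operator (written $L^{\mathrm{sym}}$ for the graph with superscript $\mathrm{sym}$). $\sigma(L)$ is its spectrum, $\lambda_0(L)=\inf\sigma(L)$, and $\sigma_{\mathrm{disc}}(L)$ is the set of isolated eigenvalues of finite multiplicity. *)

theory Defs
  imports "HOL-Analysis.Analysis"
begin

section \<open>Weighted graphs\<close>

text \<open>
  The vertex set is the whole type \<open>'v\<close>; since theorems are implicitly quantified over \<open>'v\<close>,
  this covers every countably infinite vertex set.
\<close>

definition edges :: "('v \<Rightarrow> 'v \<Rightarrow> real) \<Rightarrow> ('v \<times> 'v) set" where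
  "edges b = {(x, y). b x y > 0}"

locale weighted_graph =
  fixes b :: "'v \<Rightarrow> 'v \<Rightarrow> real" and m :: "'v \<Rightarrow> real"
  assumes countable_vertices: "countable (UNIV :: 'v set)"
    and infinite_vertices: "infinite (UNIV :: 'v set)"
    and m_pos: "m x > 0"
    and b_nonneg: "b x y \<ge> 0"
    and b_sym: "b x y = b y x"
    and b_diag: "b x x = 0"
    and connected: "(x, y) \<in> (edges b)\<^sup>*"
    and locally_finite: "finite {y. (x, y) \<in> edges b}"

definition gdist :: "('v \<Rightarrow> 'v \<Rightarrow> real) \<Rightarrow> 'v \<Rightarrow> 'v \<Rightarrow> nat" where
  "gdist b x y = (LEAST n. (x, y) \<in> edges b ^^ n)"

text \<open>The radius of a sphere is an integer, so that the sphere of radius \<open>-1\<close> is empty.\<close>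

definition sphere_at :: "('v \<Rightarrow> 'v \<Rightarrow> real) \<Rightarrow> 'v \<Rightarrow> int \<Rightarrow> 'v set" where
  "sphere_at b x0 r = {x. int (gdist b x x0) = r}"

definition ball_at :: "('v \<Rightarrow> 'v \<Rightarrow> real) \<Rightarrow> 'v \<Rightarrow> nat \<Rightarrow> 'v set" where
  "ball_at b x0 r = (\<Union>i\<le>r. sphere_at b x0 (int i))"

text \<open>All spheres are finite (lemma \<open>finite_sphere_at\<close> below), so the finite sums
  used from here on are genuine.\<close>

definition kappa_plus :: "('v \<Rightarrow> 'v \<Rightarrow> real) \<Rightarrow> ('v \<Rightarrow> real) \<Rightarrow> 'v \<Rightarrow> 'v \<Rightarrow> real" where
  "kappa_plus b m x0 x = (\<Sum>y\<in>sphere_at b x0 (int (gdist b x x0) + 1). b x y) / m x"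

definition kappa_minus :: "('v \<Rightarrow> 'v \<Rightarrow> real) \<Rightarrow> ('v \<Rightarrow> real) \<Rightarrow> 'v \<Rightarrow> 'v \<Rightarrow> real" where
  "kappa_minus b m x0 x = (\<Sum>y\<in>sphere_at b x0 (int (gdist b x x0) - 1). b x y) / m x"

locale weakly_spherically_symmetric_graph = weighted_graph b m
  for b :: "'v \<Rightarrow> 'v \<Rightarrow> real" and m :: "'v \<Rightarrow> real" +
  fixes x0 :: 'v
  assumes kappa_plus_radial:
      "gdist b x x0 = gdist b y x0 \<Longrightarrow> kappa_plus b m x0 x = kappa_plus b m x0 y"
    and kappa_minus_radial:
      "gdist b x x0 = gdist b y x0 \<Longrightarrow> kappa_minus b m x0 x = kappa_minus b m x0 y"

definition volume1 :: "('v \<Rightarrow> 'v \<Rightarrow> real) \<Rightarrow> ('v \<Rightarrow> real) \<Rightarrow> 'v \<Rightarrow> nat \<Rightarrow> real" where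
  "volume1 b m x0 r = (\<Sum>x\<in>ball_at b x0 r. m x)"

definition boundary :: "('v \<Rightarrow> 'v \<Rightarrow> real) \<Rightarrow> ('v \<Rightarrow> real) \<Rightarrow> 'v \<Rightarrow> nat \<Rightarrow> real" where
  "boundary b m x0 r = (\<Sum>x\<in>sphere_at b x0 (int r). kappa_plus b m x0 x * m x)"


section \<open>The Dirichlet form and its operator\<close>

definition ell2 :: "('v \<Rightarrow> real) \<Rightarrow> ('v \<Rightarrow> real) set" where
  "ell2 m = {f. (\<lambda>x. (f x)\<^sup>2 * m x) summable_on UNIV}"

definition ell2_inner :: "('v \<Rightarrow> real) \<Rightarrow> ('v \<Rightarrow> real) \<Rightarrow> ('v \<Rightarrow> real) \<Rightarrow> real" where
  "ell2_inner m f g = (\<Sum>\<^sub>\<infinity>x. f x * g x * m x)"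

definition ell2_norm :: "('v \<Rightarrow> real) \<Rightarrow> ('v \<Rightarrow> real) \<Rightarrow> real" where
  "ell2_norm m f = sqrt (ell2_inner m f f)"

definition finite_energy :: "('v \<Rightarrow> 'v \<Rightarrow> real) \<Rightarrow> ('v \<Rightarrow> real) set" where
  "finite_energy b = {f. (\<lambda>(x, y). b x y * (f x - f y)\<^sup>2) summable_on UNIV}"

definition energy :: "('v \<Rightarrow> 'v \<Rightarrow> real) \<Rightarrow> ('v \<Rightarrow> real) \<Rightarrow> ('v \<Rightarrow> real) \<Rightarrow> real" where
  "energy b f g = 1 / 2 * (\<Sum>\<^sub>\<infinity>(x, y). b x y * (f x - f y) * (g x - g y))"

definition fin_supp :: "('v \<Rightarrow> real) set" where
  "fin_supp = {f. finite {x. f x \<noteq> 0}}"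

text \<open>The closure of the finitely supported functions is taken inside the space of
  square summable functions of finite energy; membership of \<open>f\<close> in that space has to be demanded
  explicitly, as \<open>infsum\<close> is \<open>0\<close> on non-summable families.\<close>

definition form_dom :: "('v \<Rightarrow> 'v \<Rightarrow> real) \<Rightarrow> ('v \<Rightarrow> real) \<Rightarrow> ('v \<Rightarrow> real) set" where
  "form_dom b m = {f \<in> ell2 m \<inter> finite_energy b.
     \<exists>\<phi>. (\<forall>n. \<phi> n \<in> fin_supp) \<and>
       (\<lambda>n. ell2_inner m (\<lambda>x. f x - \<phi> n x) (\<lambda>x. f x - \<phi> n x)
           + energy b (\<lambda>x. f x - \<phi> n x) (\<lambda>x. f x - \<phi> n x)) \<longlonglongrightarrow> 0}"

text \<open>The operator associated with the closed form: \<open>f\<close> lies in its domain with value \<open>g\<close> iff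
  \<open>Q(f,h) = \<langle>g,h\<rangle>\<close> for all \<open>h\<close> in the form domain. Such a \<open>g\<close> is unique
  (lemma \<open>laplacian_eqI\<close> below).\<close>

definition laplacian_dom :: "('v \<Rightarrow> 'v \<Rightarrow> real) \<Rightarrow> ('v \<Rightarrow> real) \<Rightarrow> ('v \<Rightarrow> real) set" where
  "laplacian_dom b m = {f \<in> form_dom b m.
     \<exists>g\<in>ell2 m. \<forall>h\<in>form_dom b m. energy b f h = ell2_inner m g h}"

definition laplacian ::
    "('v \<Rightarrow> 'v \<Rightarrow> real) \<Rightarrow> ('v \<Rightarrow> real) \<Rightarrow> ('v \<Rightarrow> real) \<Rightarrow> ('v \<Rightarrow> real)" where
  "laplacian b m f =
     (THE g. g \<in> ell2 m \<and> (\<forall>h\<in>form_dom b m. energy b f h = ell2_inner m g h))"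


section \<open>Spectra of unbounded operators on the weighted sequence space\<close>

text \<open>An operator is given by its domain \<open>D\<close> and its action \<open>T\<close> on \<open>D\<close>. The Hilbert space is real
  and only real spectral parameters are considered; for a selfadjoint operator these account
  for the whole spectrum.\<close>

definition resolvent_set ::
    "('v \<Rightarrow> real) \<Rightarrow> ('v \<Rightarrow> real) set \<Rightarrow> (('v \<Rightarrow> real) \<Rightarrow> ('v \<Rightarrow> real)) \<Rightarrow> real set" where
  "resolvent_set m D T = {\<mu>.
     bij_betw (\<lambda>f x. T f x - \<mu> * f x) D (ell2 m) \<and>
     (\<exists>C. \<forall>f\<in>D. ell2_norm m f \<le> C * ell2_norm m (\<lambda>x. T f x - \<mu> * f x))}"

definition spectrum ::
    "('v \<Rightarrow> real) \<Rightarrow> ('v \<Rightarrow> real) set \<Rightarrow> (('v \<Rightarrow> real) \<Rightarrow> ('v \<Rightarrow> real)) \<Rightarrow> real set" where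
  "spectrum m D T = - resolvent_set m D T"

definition eigenspace ::
    "('v \<Rightarrow> real) set \<Rightarrow> (('v \<Rightarrow> real) \<Rightarrow> ('v \<Rightarrow> real)) \<Rightarrow> real \<Rightarrow> ('v \<Rightarrow> real) set" where
  "eigenspace D T \<mu> = {f \<in> D. T f = (\<lambda>x. \<mu> * f x)}"

definition finite_dim :: "('v \<Rightarrow> real) set \<Rightarrow> bool" where
  "finite_dim E \<longleftrightarrow>
     (\<exists>B. finite B \<and> B \<subseteq> E \<and> (\<forall>f\<in>E. \<exists>c. f = (\<lambda>x. \<Sum>g\<in>B. c g * g x)))"

definition discrete_spectrum ::
    "('v \<Rightarrow> real) \<Rightarrow> ('v \<Rightarrow> real) set \<Rightarrow> (('v \<Rightarrow> real) \<Rightarrow> ('v \<Rightarrow> real)) \<Rightarrow> real set" where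
  "discrete_spectrum m D T = {\<mu>. \<mu> isolated_in spectrum m D T \<and>
     (\<exists>f\<in>eigenspace D T \<mu>. f \<noteq> (\<lambda>x. 0)) \<and> finite_dim (eigenspace D T \<mu>)}"

text \<open>The infimum is taken in the extended reals, where it needs no side condition
  (nonempty, bounded below).\<close>

definition spectral_bottom ::
    "('v \<Rightarrow> real) \<Rightarrow> ('v \<Rightarrow> real) set \<Rightarrow> (('v \<Rightarrow> real) \<Rightarrow> ('v \<Rightarrow> real)) \<Rightarrow> ereal" where
  "spectral_bottom m D T = (INF \<mu>\<in>spectrum m D T. ereal \<mu>)"


section \<open>Well-definedness\<close>

context weighted_graph
begin

lemma edges_sym: "(x, y) \<in> edges b \<longleftrightarrow> (y, x) \<in> edges b"
  using b_sym by (simp add: edges_def)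

lemma gdist_path: "(x, y) \<in> edges b ^^ gdist b x y"
  using connected[of x y] rtrancl_imp_relpow unfolding gdist_def by (metis LeastI)

lemma gdist_le: "(x, y) \<in> edges b ^^ n \<Longrightarrow> gdist b x y \<le> n"
  unfolding gdist_def by (rule Least_le)

lemma gdist_pred:
  assumes "gdist b x x0 = Suc n"
  obtains y where "(x, y) \<in> edges b" "gdist b y x0 = n"
proof -
  have "(x, x0) \<in> edges b ^^ Suc n" using gdist_path[of x x0] assms by simp
  then obtain y where y: "(x, y) \<in> edges b" "(y, x0) \<in> edges b ^^ n"
    by (meson relpow_Suc_D2)
  moreover have "(x, x0) \<in> edges b ^^ Suc (gdist b y x0)"
    using y(1) gdist_path relpow_Suc_I2 by metis
  ultimately have "gdist b y x0 \<le> n" "gdist b x x0 \<le> Suc (gdist b y x0)"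
    using gdist_le by blast+
  then show ?thesis using that y(1) assms by simp
qed

lemma finite_sphere_at: "finite (sphere_at b x0 r)"
proof -
  have "finite {x. gdist b x x0 = n}" for n
  proof (induction n)
    case 0
    have "x = x0" if "gdist b x x0 = 0" for x using gdist_path[of x x0] that by simp
    then have "{x. gdist b x x0 = 0} \<subseteq> {x0}" by blast
    then show ?case by (rule finite_subset) simp
  next
    case (Suc n)
    have "{x. gdist b x x0 = Suc n} \<subseteq> (\<Union>y\<in>{y. gdist b y x0 = n}. {x. (y, x) \<in> edges b})"
    proof
      fix x assume "x \<in> {x. gdist b x x0 = Suc n}"
      then obtain y where "(x, y) \<in> edges b" "gdist b y x0 = n"
        using gdist_pred[of x x0 n] by auto
      then show "x \<in> (\<Union>y\<in>{y. gdist b y x0 = n}. {x. (y, x) \<in> edges b})"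
        using edges_sym[of x y] by auto
    qed
    moreover have "finite (\<Union>y\<in>{y. gdist b y x0 = n}. {x. (y, x) \<in> edges b})"
      using Suc locally_finite by (rule finite_UN_I)
    ultimately show ?case by (rule finite_subset)
  qed
  moreover have "sphere_at b x0 r \<subseteq> {x. gdist b x x0 = nat r}"
    by (auto simp: sphere_at_def)
  ultimately show ?thesis using finite_subset by blast
qed

lemma sphere_at_nonempty: "sphere_at b x0 (int r) \<noteq> {}"
proof
  assume *: "sphere_at b x0 (int r) = {}"
  have "sphere_at b x0 (int (r + k)) = {}" for k
  proof (induction k)
    case (Suc k)
    have False if x: "x \<in> sphere_at b x0 (int (r + Suc k))" for x
    proof -
      have "gdist b x x0 = Suc (r + k)" using x by (simp add: sphere_at_def)
      then obtain y where "gdist b y x0 = r + k" by (rule gdist_pred)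
      then have "y \<in> sphere_at b x0 (int (r + k))" by (simp add: sphere_at_def)
      then show False using Suc by blast
    qed
    then show ?case by blast
  qed (use * in simp)
  then have empty: "x \<notin> sphere_at b x0 (int (r + k))" for x k
    by simp
  have "gdist b x x0 < r" for x
  proof (rule ccontr)
    assume "\<not> gdist b x x0 < r"
    then have "x \<in> sphere_at b x0 (int (r + (gdist b x x0 - r)))"
      by (simp add: sphere_at_def)
    then show False using empty by blast
  qed
  then have "UNIV \<subseteq> (\<Union>i<r. sphere_at b x0 (int i))"
    by (auto simp: sphere_at_def)
  then show False using finite_sphere_at infinite_vertices
    by (meson finite_UN finite_lessThan finite_subset)
qed

lemma boundary_pos: "boundary b m x0 r > 0"
proof -
  obtain y where "y \<in> sphere_at b x0 (int (Suc r))" using sphere_at_nonempty by blast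
  then have yr: "gdist b y x0 = Suc r" by (simp add: sphere_at_def)
  then obtain x where x: "(y, x) \<in> edges b" "gdist b x x0 = r" by (rule gdist_pred)
  have nn: "kappa_plus b m x0 z * m z \<ge> 0" for z
    using m_pos[of z] by (simp add: kappa_plus_def b_nonneg sum_nonneg)
  have "b x y > 0" using x(1) b_sym by (simp add: edges_def)
  then have "(\<Sum>y\<in>sphere_at b x0 (int r + 1). b x y) > 0"
    using yr by (intro sum_pos2[OF finite_sphere_at, of y]) (auto simp: b_nonneg sphere_at_def)
  then have "kappa_plus b m x0 x * m x > 0"
    using m_pos[of x] x(2) by (simp add: kappa_plus_def)
  then show ?thesis
    unfolding boundary_def using x(2) nn
    by (intro sum_pos2[OF finite_sphere_at, of x]) (auto simp: sphere_at_def)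
qed

lemma fin_supp_subset_form_dom: "fin_supp \<subseteq> form_dom b m"
proof
  fix f :: "'v \<Rightarrow> real" assume f: "f \<in> fin_supp"
  let ?S = "{x. f x \<noteq> 0}"
  have S: "finite ?S" using f by (simp add: fin_supp_def)
  have "(\<lambda>x. (f x)\<^sup>2 * m x) summable_on UNIV"
    by (rule summable_on_cong_neutral[THEN iffD1, OF _ _ _ summable_on_finite[OF S]]) auto
  moreover have "(\<lambda>(x, y). b x y * (f x - f y)\<^sup>2) summable_on UNIV"
  proof -
    let ?N = "\<lambda>x. {y. (x, y) \<in> edges b}"
    let ?E = "(SIGMA x:?S. ?N x) \<union> (\<lambda>(x, y). (y, x)) ` (SIGMA x:?S. ?N x)"
    have "finite ?E" using S locally_finite by blast
    moreover have "b x y * (f x - f y)\<^sup>2 = 0" if "(x, y) \<notin> ?E" for x y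
    proof (rule ccontr)
      assume *: "b x y * (f x - f y)\<^sup>2 \<noteq> 0"
      then have "(x, y) \<in> edges b" using b_nonneg[of x y] by (auto simp: edges_def)
      moreover have "f x \<noteq> 0 \<or> f y \<noteq> 0" using * by auto
      ultimately show False using that edges_sym[of x y] by (auto simp: image_iff)
    qed
    then have "{z. (case z of (x, y) \<Rightarrow> b x y * (f x - f y)\<^sup>2) \<noteq> 0} \<subseteq> ?E"
      unfolding subset_iff split_paired_All mem_Collect_eq prod.case by metis
    ultimately show ?thesis
      by (intro finite_nonzero_values_imp_summable_on) (simp add: finite_subset)
  qed
  moreover have "energy b (\<lambda>_. 0) (\<lambda>_. 0) = 0"
    unfolding energy_def by (simp add: infsum_0)
  then have "(\<lambda>n :: nat. ell2_inner m (\<lambda>x. f x - f x) (\<lambda>x. f x - f x)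
      + energy b (\<lambda>x. f x - f x) (\<lambda>x. f x - f x)) \<longlonglongrightarrow> 0"
    by (simp add: ell2_inner_def)
  ultimately show "f \<in> form_dom b m"
    unfolding form_dom_def ell2_def finite_energy_def using f
    by (intro CollectI conjI IntI exI[of _ "\<lambda>_. f"]) simp_all
qed

lemma laplacian_eqI:
  assumes "g \<in> ell2 m" and "\<And>h. h \<in> form_dom b m \<Longrightarrow> energy b f h = ell2_inner m g h"
  shows "laplacian b m f = g"
  unfolding laplacian_def
proof (rule the_equality)
  fix g' assume g': "g' \<in> ell2 m \<and> (\<forall>h\<in>form_dom b m. energy b f h = ell2_inner m g' h)"
  show "g' = g"
  proof
    fix x
    let ?d = "\<lambda>y :: 'v. if y = x then 1 else 0 :: real"
    have "?d \<in> form_dom b m" using fin_supp_subset_form_dom by (auto simp: fin_supp_def)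
    then have "ell2_inner m g' ?d = ell2_inner m g ?d" using assms(2) g' by metis
    moreover have "ell2_inner m k ?d = k x * m x" for k
    proof -
      have "ell2_inner m k ?d = (\<Sum>\<^sub>\<infinity>y\<in>{x}. k y * ?d y * m y)"
        unfolding ell2_inner_def by (rule infsum_cong_neutral) auto
      then show ?thesis by simp
    qed
    ultimately show "g' x = g x" using m_pos[of x] by simp
  qed
qed (use assms in auto)

end

end

theory Submission
  imports Defs "HOL-Complex_Analysis.Great_Picard"
begin

text \<open>
  Write \<open>L\<close> for the formal Laplacian, \<open>L v x = (\<Sum>y. b x y * (v x - v y)) / m x\<close>, and let
  \<open>R r\<close> be the tail \<open>(\<Sum>k. V\<^sub>1(r + k) / \<partial>B(r + k))\<close> of the given series. The function
  \<open>v x = R (d(x, x\<^sub>0))\<close> is positive, at most \<open>a\<close>, tends to 0 at infinity, and satisfies \<open>L v = 1\<close>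
  everywhere: multiplied by the measure of the sphere \<open>S\<^sub>r\<close>, the outward flux is \<open>V\<^sub>1(r)\<close>, the
  inward flux is \<open>V\<^sub>1(r - 1)\<close>, and their difference is the measure of \<open>S\<^sub>r\<close>
  (lemma \<open>flux_balance\<close>). The two conditions of weak spherical symmetry are what makes this
  averaged computation valid at each single vertex.

  A positive function with \<open>L v = 1\<close> yields, through an elementary inequality of Picone type on each
  edge, the Hardy inequality \<open>(\<Sum>x. (f x)\<^sup>2 * m x / v x) \<le> Q(f, f)\<close>. It is used in the form
  \<open>\<parallel>f\<parallel>\<^sup>2 \<le> (\<Sum>x\<in>F. m x * (f x)\<^sup>2) + \<epsilon> * Q(f, f)\<close> for every finite \<open>F\<close> off which \<open>v \<le> \<epsilon>\<close>
  (lemma \<open>hardy_inequality\<close>). With \<open>F = {}\<close> and \<open>\<epsilon> = a\<close> this bounds the form below by \<open>1 / a\<close>. With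
  \<open>\<epsilon>\<close> small and \<open>F\<close> a large ball it says that mass cannot escape to infinity at bounded energy, so
  that the form domain embeds compactly into \<open>\<ell>\<^sup>2\<close> (lemma \<open>bounded_energy_subsequence\<close>).

  What remains is spectral theory of a form with compact embedding (locale \<open>tight_form\<close>). Everything
  rests on one closure statement, lemma \<open>has_laplacian_subsequence\<close>: functions that solve
  \<open>Q(f, h) = \<langle>\<mu> f + g, h\<rangle>\<close> for more and more test functions \<open>h\<close>, with \<open>\<parallel>f\<parallel>\<close> bounded and \<open>g\<close>
  convergent, subconverge to an element of the operator domain. It is applied three times.
  If \<open>\<mu>\<close> is not an eigenvalue, normalised solutions on finite sets with right-hand sides tending to 0
  cannot exist, whence a uniform bound for the Galerkin problems on large finite sets
  (\<open>galerkin_bound\<close>); this bound makes these finite square systems uniquely solvable, and their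
  solutions subconverge to a solution of \<open>L f - \<mu> f = g\<close> (\<open>resolvent_exists\<close>). So every spectral
  point is an eigenvalue, hence at least \<open>1 / a\<close>. Finally, normalised eigenvectors for
  eigenvalues \<open>\<nu>\<^sub>k \<noteq> \<mu>\<close> with \<open>\<nu>\<^sub>k \<rightarrow> \<mu>\<close> would subconverge to an eigenvector for \<open>\<mu>\<close> to which all of
  them are orthogonal (\<open>spectrum_isolated\<close>). Eigenspaces are finite-dimensional because
  eigenvectors are determined by their values on a finite set.
\<close>

section \<open>Weighted square summable families\<close>

text \<open>
  The inner product of \<open>\<ell>\<^sup>2(V, m)\<close> and the Dirichlet form are both of this kind: the first with the
  vertices as index set and weight \<open>m\<close>, the second with pairs of vertices, weight \<open>b\<close> and the
  differences \<open>f x - f y\<close>, up to the factor 1/2. As \<open>b\<close> vanishes on many pairs, weights may be 0.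
\<close>

definition wip :: "('i \<Rightarrow> real) \<Rightarrow> ('i \<Rightarrow> real) \<Rightarrow> ('i \<Rightarrow> real) \<Rightarrow> real" where
  "wip w u v = (\<Sum>\<^sub>\<infinity>i. w i * u i * v i)"

definition wl2 :: "('i \<Rightarrow> real) \<Rightarrow> ('i \<Rightarrow> real) set" where
  "wl2 w = {u. (\<lambda>i. w i * (u i)\<^sup>2) summable_on UNIV}"

lemma wip_commute: "wip w u v = wip w v u"
  unfolding wip_def by (simp add: mult.assoc mult.commute[of "u _"])

locale weight =
  fixes w :: "'i \<Rightarrow> real"
  assumes weight_nonneg: "w i \<ge> 0"
begin

lemma wl2_add: "u \<in> wl2 w \<Longrightarrow> v \<in> wl2 w \<Longrightarrow> (\<lambda>i. u i + v i) \<in> wl2 w"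
proof -
  assume u: "u \<in> wl2 w" and v: "v \<in> wl2 w"
  have "(\<lambda>i. 2 * (w i * (u i)\<^sup>2) + 2 * (w i * (v i)\<^sup>2)) summable_on UNIV"
    using u v unfolding wl2_def by (intro summable_on_add summable_on_cmult_right) auto
  then show ?thesis unfolding wl2_def mem_Collect_eq
  proof (rule summable_on_comparison_test)
    fix i
    have "(u i + v i)\<^sup>2 \<le> 2 * (u i)\<^sup>2 + 2 * (v i)\<^sup>2"
      using sum_squares_bound[of "u i" "v i"] by (simp add: power2_sum)
    then have "w i * (u i + v i)\<^sup>2 \<le> w i * (2 * (u i)\<^sup>2 + 2 * (v i)\<^sup>2)"
      by (rule mult_left_mono) (rule weight_nonneg)
    then show "w i * (u i + v i)\<^sup>2 \<le> 2 * (w i * (u i)\<^sup>2) + 2 * (w i * (v i)\<^sup>2)"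
      by (simp add: algebra_simps)
  qed (simp add: weight_nonneg)
qed

lemma wl2_scale: "u \<in> wl2 w \<Longrightarrow> (\<lambda>i. c * u i) \<in> wl2 w"
  unfolding wl2_def mem_Collect_eq
  by (drule summable_on_cmult_right[where c = "c\<^sup>2"]) (simp add: power_mult_distrib ac_simps)

lemma wl2_diff: "u \<in> wl2 w \<Longrightarrow> v \<in> wl2 w \<Longrightarrow> (\<lambda>i. u i - v i) \<in> wl2 w"
  using wl2_add[of u "\<lambda>i. -1 * v i"] wl2_scale[of v "-1"] by simp

lemma wl2_prod_summable:
  assumes "u \<in> wl2 w" "v \<in> wl2 w"
  shows "(\<lambda>i. w i * u i * v i) summable_on UNIV"
proof -
  have "(\<lambda>i. w i * u i * v i) = (\<lambda>i. 1 / 2 * (w i * (u i + v i)\<^sup>2)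
      + (- 1 / 2 * (w i * (u i)\<^sup>2) + - 1 / 2 * (w i * (v i)\<^sup>2)))"
    by (auto simp: power2_eq_square algebra_simps)
  moreover have "\<dots> summable_on UNIV"
    using assms wl2_add[OF assms] unfolding wl2_def
    by (intro summable_on_add summable_on_cmult_right) auto
  ultimately show ?thesis by simp
qed

lemma wip_add_left:
  assumes "u \<in> wl2 w" "v \<in> wl2 w" "z \<in> wl2 w"
  shows "wip w (\<lambda>i. u i + v i) z = wip w u z + wip w v z"
  using infsum_add[OF wl2_prod_summable[OF assms(1,3)] wl2_prod_summable[OF assms(2,3)]]
  by (simp add: wip_def algebra_simps)

lemma wip_scale_left: "wip w (\<lambda>i. c * u i) v = c * wip w u v"
proof -
  have "(\<lambda>i. w i * (c * u i) * v i) = (\<lambda>i. c * (w i * u i * v i))" by auto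
  then show ?thesis by (simp add: wip_def infsum_cmult_right')
qed

lemma wip_diff_left:
  assumes "u \<in> wl2 w" "v \<in> wl2 w" "z \<in> wl2 w"
  shows "wip w (\<lambda>i. u i - v i) z = wip w u z - wip w v z"
  using wip_add_left[of u "\<lambda>i. -1 * v i" z] wl2_scale[of v "-1"] wip_scale_left[of "-1" v z] assms
  by simp

lemma wip_add_right:
  assumes "u \<in> wl2 w" "v \<in> wl2 w" "z \<in> wl2 w"
  shows "wip w z (\<lambda>i. u i + v i) = wip w z u + wip w z v"
  using wip_add_left[OF assms] by (simp add: wip_commute)

lemma wip_scale_right: "wip w v (\<lambda>i. c * u i) = c * wip w v u"
  using wip_scale_left[of c u v] by (simp add: wip_commute)

lemma wip_diff_right:
  assumes "u \<in> wl2 w" "v \<in> wl2 w" "z \<in> wl2 w"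
  shows "wip w z (\<lambda>i. u i - v i) = wip w z u - wip w z v"
  using wip_diff_left[OF assms] by (simp add: wip_commute)

lemma wip_self_nonneg: "wip w u u \<ge> 0"
  unfolding wip_def by (intro infsum_nonneg) (simp add: weight_nonneg mult.assoc)

lemma wip_diff_self:
  assumes "u \<in> wl2 w" "v \<in> wl2 w"
  shows "wip w (\<lambda>i. u i - v i) (\<lambda>i. u i - v i) = wip w u u + wip w v v - 2 * wip w u v"
  using assms by (simp add: wip_diff_left wip_diff_right wl2_diff wip_commute[of w v u])

lemma wip_diff_self_commute:
  "wip w (\<lambda>i. u i - v i) (\<lambda>i. u i - v i) = wip w (\<lambda>i. v i - u i) (\<lambda>i. v i - u i)"
  unfolding wip_def by (rule infsum_cong) (simp add: algebra_simps)

text \<open>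
  The form is only semidefinite, so the case of a null vector \<open>v\<close> is separate: there the quadratic
  polynomial in \<open>t\<close> degenerates to a linear one, which is nonnegative only if its slope is 0.
\<close>

lemma wip_cauchy_schwarz:
  assumes "u \<in> wl2 w" "v \<in> wl2 w"
  shows "\<bar>wip w u v\<bar> \<le> sqrt (wip w u u) * sqrt (wip w v v)"
proof -
  have q: "0 \<le> wip w u u - 2 * t * wip w u v + t\<^sup>2 * wip w v v" for t
    using wip_self_nonneg[of "\<lambda>i. u i - t * v i"] wip_diff_self[OF assms(1) wl2_scale[OF assms(2)], of t]
    by (simp add: wip_scale_left wip_scale_right power2_eq_square)
  have "(wip w u v)\<^sup>2 \<le> wip w u u * wip w v v"
  proof (cases "wip w v v = 0")
    case True
    have "wip w u v = 0"
    proof (rule ccontr)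
      assume nz: "wip w u v \<noteq> 0"
      show False
        using q[of "(wip w u u + 1) / (2 * wip w u v)"] nz True by (simp add: field_simps)
    qed
    then show ?thesis by (simp add: True)
  next
    case False
    then have pos: "wip w v v > 0" using wip_self_nonneg[of v] by simp
    have "0 \<le> wip w u u - (wip w u v)\<^sup>2 / wip w v v"
      using q[of "wip w u v / wip w v v"] pos by (simp add: field_simps power2_eq_square)
    then show ?thesis using pos by (simp add: field_simps)
  qed
  then have "sqrt ((wip w u v)\<^sup>2) \<le> sqrt (wip w u u * wip w v v)" by (rule real_sqrt_le_mono)
  then show ?thesis by (simp add: real_sqrt_mult)
qed

lemma wip_diff_self_le:
  assumes "u \<in> wl2 w" "v \<in> wl2 w"
  shows "wip w (\<lambda>i. u i - v i) (\<lambda>i. u i - v i) \<le> 2 * wip w u u + 2 * wip w v v"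
proof -
  have "wip w (\<lambda>i. u i + v i) (\<lambda>i. u i + v i) \<ge> 0" by (rule wip_self_nonneg)
  then have "wip w u u + wip w v v + 2 * wip w u v \<ge> 0"
    using assms by (simp only: wip_add_left wip_add_right wl2_add wip_commute[of w v u])
  then show ?thesis using wip_diff_self[OF assms] by simp
qed

lemma wip_triangle:
  assumes "u \<in> wl2 w" "v \<in> wl2 w" "z \<in> wl2 w"
  shows "wip w (\<lambda>i. u i - z i) (\<lambda>i. u i - z i)
    \<le> 2 * wip w (\<lambda>i. u i - v i) (\<lambda>i. u i - v i) + 2 * wip w (\<lambda>i. v i - z i) (\<lambda>i. v i - z i)"
proof -
  have "(\<lambda>i. u i - z i) = (\<lambda>i. (u i - v i) - (z i - v i))" by auto
  then show ?thesis
    using wip_diff_self_le[OF wl2_diff[OF assms(1,2)] wl2_diff[OF assms(3,2)]]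
    by (simp only: wip_diff_self_commute[of z v])
qed

lemma finite_sum_le_wip:
  assumes "u \<in> wl2 w" "finite F"
  shows "(\<Sum>i\<in>F. w i * (u i)\<^sup>2) \<le> wip w u u"
proof -
  have "(\<Sum>i\<in>F. w i * (u i)\<^sup>2) \<le> (\<Sum>\<^sub>\<infinity>i. w i * (u i)\<^sup>2)"
    using assms by (intro finite_sum_le_infsum) (auto simp: wl2_def weight_nonneg)
  then show ?thesis by (simp add: wip_def power2_eq_square mult.assoc)
qed

lemma wip_le_finite_sums:
  assumes "\<And>F. finite F \<Longrightarrow> (\<Sum>i\<in>F. w i * (u i)\<^sup>2) \<le> C"
  shows "u \<in> wl2 w" "wip w u u \<le> C"
proof -
  show u: "u \<in> wl2 w" unfolding wl2_def mem_Collect_eq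
    using assms by (intro nonneg_bdd_above_summable_on) (auto simp: bdd_above_def weight_nonneg)
  then have "(\<Sum>\<^sub>\<infinity>i. w i * (u i)\<^sup>2) \<le> C"
    using assms by (intro infsum_le_finite_sums) (auto simp: wl2_def)
  then show "wip w u u \<le> C" by (simp add: wip_def power2_eq_square mult.assoc)
qed

text \<open>
  Fatou's lemma: partial sums over finite sets pass to the pointwise limit.
\<close>

lemma wip_fatou:
  assumes "\<And>k. u k \<in> wl2 w" "\<And>i. (\<lambda>k. u k i) \<longlonglongrightarrow> v i"
    and "\<forall>\<^sub>F k in sequentially. wip w (u k) (u k) \<le> C"
  shows "v \<in> wl2 w" "wip w v v \<le> C"
proof -
  have "(\<Sum>i\<in>F. w i * (v i)\<^sup>2) \<le> C" if F: "finite F" for F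
  proof (rule tendsto_upperbound)
    show "(\<lambda>k. \<Sum>i\<in>F. w i * (u k i)\<^sup>2) \<longlonglongrightarrow> (\<Sum>i\<in>F. w i * (v i)\<^sup>2)"
      by (intro tendsto_intros assms(2))
    show "\<forall>\<^sub>F k in sequentially. (\<Sum>i\<in>F. w i * (u k i)\<^sup>2) \<le> C"
      using assms(3) by eventually_elim (rule order_trans[OF finite_sum_le_wip[OF assms(1) F]])
  qed simp
  then show "v \<in> wl2 w" "wip w v v \<le> C" using wip_le_finite_sums[of v C] by blast+
qed

text \<open>
  Completeness, in a form where the pointwise limit is already known. This is what allows a limit
  to be identified without constructing a Hilbert space. The Cauchy condition lets the second index
  become large only after the first is chosen; a Galerkin solution satisfies the equation tested
  against an earlier one only from some index on.
\<close>

lemma wip_cauchy_limit: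
  assumes u: "\<And>k. u k \<in> wl2 w" and v: "\<And>i. (\<lambda>k. u k i) \<longlonglongrightarrow> v i"
    and cauchy: "\<And>\<epsilon>. \<epsilon> > 0 \<Longrightarrow> \<forall>\<^sub>F j in sequentially. \<forall>\<^sub>F k in sequentially.
      wip w (\<lambda>i. u k i - u j i) (\<lambda>i. u k i - u j i) \<le> \<epsilon>"
  shows "v \<in> wl2 w" "(\<lambda>k. wip w (\<lambda>i. u k i - v i) (\<lambda>i. u k i - v i)) \<longlonglongrightarrow> 0"
proof -
  have *: "\<forall>\<^sub>F j in sequentially. (\<lambda>i. v i - u j i) \<in> wl2 w \<and>
      wip w (\<lambda>i. v i - u j i) (\<lambda>i. v i - u j i) \<le> \<epsilon>" if "\<epsilon> > 0" for \<epsilon>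
    using cauchy[OF that]
  proof eventually_elim
    case (elim j)
    have "(\<lambda>k. u k i - u j i) \<longlonglongrightarrow> v i - u j i" for i by (intro tendsto_intros v)
    then show ?case
      using wip_fatou[of "\<lambda>k i. u k i - u j i" "\<lambda>i. v i - u j i" \<epsilon>] elim u wl2_diff by blast
  qed
  obtain j where "(\<lambda>i. v i - u j i) \<in> wl2 w"
    using *[of 1] eventually_happens'[OF sequentially_bot] by fastforce
  from wl2_add[OF this u[of j]] show "v \<in> wl2 w" by simp
  show "(\<lambda>k. wip w (\<lambda>i. u k i - v i) (\<lambda>i. u k i - v i)) \<longlonglongrightarrow> 0"
  proof (rule tendstoI)
    fix e :: real assume "e > 0"
    then have "\<forall>\<^sub>F j in sequentially. (\<lambda>i. v i - u j i) \<in> wl2 w \<and>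
      wip w (\<lambda>i. v i - u j i) (\<lambda>i. v i - u j i) \<le> e / 2" by (intro *) simp
    then show "\<forall>\<^sub>F k in sequentially. dist (wip w (\<lambda>i. u k i - v i) (\<lambda>i. u k i - v i)) 0 < e"
    proof eventually_elim
      case (elim k)
      then have "wip w (\<lambda>i. u k i - v i) (\<lambda>i. u k i - v i) \<le> e / 2"
        by (subst wip_diff_self_commute) simp
      then show ?case using \<open>e > 0\<close> wip_self_nonneg[of "\<lambda>i. u k i - v i"]
        by (simp add: dist_real_def)
    qed
  qed
qed

lemma wip_tendsto:
  assumes u: "\<And>k. u k \<in> wl2 w" "u' \<in> wl2 w" and v: "\<And>k. v k \<in> wl2 w" "v' \<in> wl2 w"
    and cu: "(\<lambda>k. wip w (\<lambda>i. u k i - u' i) (\<lambda>i. u k i - u' i)) \<longlonglongrightarrow> 0"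
    and cv: "(\<lambda>k. wip w (\<lambda>i. v k i - v' i) (\<lambda>i. v k i - v' i)) \<longlonglongrightarrow> 0"
  shows "(\<lambda>k. wip w (u k) (v k)) \<longlonglongrightarrow> wip w u' v'"
proof -
  let ?p = "\<lambda>k i. u k i - u' i" and ?q = "\<lambda>k i. v k i - v' i"
  have p: "?p k \<in> wl2 w" and q: "?q k \<in> wl2 w" for k using u v wl2_diff by auto
  have small: "(\<lambda>k. wip w (f k) (g k)) \<longlonglongrightarrow> 0"
    if "\<And>k. f k \<in> wl2 w" "\<And>k. g k \<in> wl2 w" "(\<lambda>k. sqrt (wip w (f k) (f k)) * sqrt (wip w (g k) (g k))) \<longlonglongrightarrow> 0"
    for f g :: "nat \<Rightarrow> 'i \<Rightarrow> real"
    by (rule tendsto_rabs_zero_cancel, rule tendsto_sandwich[OF _ _ tendsto_const that(3)])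
       (auto simp: wip_cauchy_schwarz that)
  have su: "(\<lambda>k. sqrt (wip w (?p k) (?p k))) \<longlonglongrightarrow> 0" and sv: "(\<lambda>k. sqrt (wip w (?q k) (?q k))) \<longlonglongrightarrow> 0"
    using tendsto_real_sqrt[OF cu] tendsto_real_sqrt[OF cv] by simp_all
  have 1: "(\<lambda>k. wip w (?p k) (?q k)) \<longlonglongrightarrow> 0"
    using tendsto_mult[OF su sv] by (intro small p q) simp
  have 2: "(\<lambda>k. wip w (?p k) v') \<longlonglongrightarrow> 0"
    using tendsto_mult_left_zero[OF su] by (intro small p v) simp
  have 3: "(\<lambda>k. wip w u' (?q k)) \<longlonglongrightarrow> 0"
    using tendsto_mult_right_zero[OF sv] by (intro small q u) simp
  have "wip w (u k) (v k) = wip w (?p k) (?q k) + wip w (?p k) v' + wip w u' (?q k) + wip w u' v'" for k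
    using u v by (simp add: wip_diff_left wip_diff_right wl2_diff)
  moreover have "(\<lambda>k. wip w (?p k) (?q k) + wip w (?p k) v' + wip w u' (?q k) + wip w u' v') \<longlonglongrightarrow> 0 + 0 + 0 + wip w u' v'"
    by (intro tendsto_add 1 2 3 tendsto_const)
  ultimately show ?thesis by simp
qed

end

section \<open>The Dirichlet form\<close>

definition gradient :: "('v \<Rightarrow> real) \<Rightarrow> 'v \<times> 'v \<Rightarrow> real" where
  "gradient f = (\<lambda>(x, y). f x - f y)"

lemma gradient_diff: "gradient (\<lambda>x. f x - g x) = (\<lambda>i. gradient f i - gradient g i)"
  and gradient_scale: "gradient (\<lambda>x. c * f x) = (\<lambda>i. c * gradient f i)"
  by (auto simp: gradient_def algebra_simps)

lemma ell2_eq: "ell2 m = wl2 m"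
  by (simp add: ell2_def wl2_def mult.commute)

lemma ell2_inner_eq: "ell2_inner m f g = wip m f g"
  by (simp add: ell2_inner_def wip_def mult.commute mult.left_commute)

lemma finite_energy_eq: "f \<in> finite_energy b \<longleftrightarrow> gradient f \<in> wl2 (case_prod b)"
  by (simp add: finite_energy_def wl2_def gradient_def case_prod_unfold)

lemma energy_eq: "energy b f g = 1 / 2 * wip (case_prod b) (gradient f) (gradient g)"
  by (simp add: energy_def wip_def gradient_def case_prod_unfold)

context weighted_graph
begin

sublocale vtx: weight m
  by unfold_locales (simp add: m_pos less_imp_le)

sublocale edg: weight "case_prod b"
  by unfold_locales (auto simp: b_nonneg)

lemma form_domI:
  assumes "f \<in> wl2 m" "f \<in> finite_energy b" "\<And>n. \<phi> n \<in> fin_supp"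
    and "(\<lambda>n. wip m (\<lambda>x. \<phi> n x - f x) (\<lambda>x. \<phi> n x - f x)) \<longlonglongrightarrow> 0"
    and "(\<lambda>n. energy b (\<lambda>x. \<phi> n x - f x) (\<lambda>x. \<phi> n x - f x)) \<longlonglongrightarrow> 0"
  shows "f \<in> form_dom b m"
proof -
  have "energy b (\<lambda>x. \<phi> n x - f x) (\<lambda>x. \<phi> n x - f x) = energy b (\<lambda>x. f x - \<phi> n x) (\<lambda>x. f x - \<phi> n x)" for n
    by (simp add: energy_eq gradient_diff edg.wip_diff_self_commute)
  then show ?thesis
    using tendsto_add[OF assms(4,5)] assms(1-3)
    by (auto simp: form_dom_def ell2_eq ell2_inner_eq vtx.wip_diff_self_commute[of f])
qed

lemma energy_self_nonneg: "energy b f f \<ge> 0"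
  by (simp add: energy_eq edg.wip_self_nonneg)

lemma energy_commute: "energy b f g = energy b g f"
  by (simp add: energy_eq wip_commute)

lemma form_dom_ell2: "f \<in> form_dom b m \<Longrightarrow> f \<in> wl2 m"
  by (simp add: form_dom_def ell2_eq)

lemma form_dom_gradient: "f \<in> form_dom b m \<Longrightarrow> gradient f \<in> wl2 (case_prod b)"
  by (simp add: form_dom_def finite_energy_eq)

lemma form_dom_approx:
  assumes "f \<in> form_dom b m"
  obtains \<phi> where "\<And>n. \<phi> n \<in> fin_supp"
    "(\<lambda>n. wip m (\<lambda>x. \<phi> n x - f x) (\<lambda>x. \<phi> n x - f x)) \<longlonglongrightarrow> 0"
    "(\<lambda>n. energy b (\<lambda>x. \<phi> n x - f x) (\<lambda>x. \<phi> n x - f x)) \<longlonglongrightarrow> 0"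
proof -
  obtain \<phi> where \<phi>: "\<And>n. \<phi> n \<in> fin_supp"
    "(\<lambda>n. wip m (\<lambda>x. f x - \<phi> n x) (\<lambda>x. f x - \<phi> n x)
      + energy b (\<lambda>x. f x - \<phi> n x) (\<lambda>x. f x - \<phi> n x)) \<longlonglongrightarrow> 0"
    using assms by (auto simp: form_dom_def ell2_inner_eq)
  have e: "energy b (\<lambda>x. \<phi> n x - f x) (\<lambda>x. \<phi> n x - f x) = energy b (\<lambda>x. f x - \<phi> n x) (\<lambda>x. f x - \<phi> n x)" for n
    by (simp add: energy_eq gradient_diff edg.wip_diff_self_commute)
  show ?thesis
  proof (rule that[OF \<phi>(1)])
    show "(\<lambda>n. wip m (\<lambda>x. \<phi> n x - f x) (\<lambda>x. \<phi> n x - f x)) \<longlonglongrightarrow> 0"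
      by (rule tendsto_sandwich[OF _ _ tendsto_const \<phi>(2)])
         (simp_all add: vtx.wip_self_nonneg energy_self_nonneg vtx.wip_diff_self_commute[of f])
    show "(\<lambda>n. energy b (\<lambda>x. \<phi> n x - f x) (\<lambda>x. \<phi> n x - f x)) \<longlonglongrightarrow> 0"
      unfolding e
      by (rule tendsto_sandwich[OF _ _ tendsto_const \<phi>(2)])
         (simp_all add: vtx.wip_self_nonneg energy_self_nonneg)
  qed
qed

lemma energy_tendsto:
  assumes "\<And>k. u k \<in> form_dom b m" "u' \<in> form_dom b m" "\<And>k. v k \<in> form_dom b m" "v' \<in> form_dom b m"
    and "(\<lambda>k. energy b (\<lambda>x. u k x - u' x) (\<lambda>x. u k x - u' x)) \<longlonglongrightarrow> 0"
    and "(\<lambda>k. energy b (\<lambda>x. v k x - v' x) (\<lambda>x. v k x - v' x)) \<longlonglongrightarrow> 0"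
  shows "(\<lambda>k. energy b (u k) (v k)) \<longlonglongrightarrow> energy b u' v'"
proof -
  have "(\<lambda>k. wip (case_prod b) (\<lambda>i. gradient (u k) i - gradient u' i) (\<lambda>i. gradient (u k) i - gradient u' i)) \<longlonglongrightarrow> 0"
    using tendsto_mult_left[OF assms(5), of 2] by (simp add: energy_eq gradient_diff)
  moreover have "(\<lambda>k. wip (case_prod b) (\<lambda>i. gradient (v k) i - gradient v' i) (\<lambda>i. gradient (v k) i - gradient v' i)) \<longlonglongrightarrow> 0"
    using tendsto_mult_left[OF assms(6), of 2] by (simp add: energy_eq gradient_diff)
  ultimately have "(\<lambda>k. wip (case_prod b) (gradient (u k)) (gradient (v k))) \<longlonglongrightarrow> wip (case_prod b) (gradient u') (gradient v')"
    using assms(1-4) form_dom_gradient by (intro edg.wip_tendsto) auto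
  then show ?thesis unfolding energy_eq by (intro tendsto_intros)
qed

text \<open>
  The form domain is defined as a closure by sequences, so it is closed by a diagonal choice
  of approximants.
\<close>

lemma form_dom_closed:
  assumes f: "\<And>k. f k \<in> form_dom b m" and g: "g \<in> wl2 m" "g \<in> finite_energy b"
    and lim: "(\<lambda>k. wip m (\<lambda>x. f k x - g x) (\<lambda>x. f k x - g x)) \<longlonglongrightarrow> 0"
      "(\<lambda>k. energy b (\<lambda>x. f k x - g x) (\<lambda>x. f k x - g x)) \<longlonglongrightarrow> 0"
  shows "g \<in> form_dom b m"
proof -
  let ?N = "\<lambda>f. wip m f f" and ?E = "\<lambda>f. energy b f f"
  have "\<exists>\<phi>. \<phi> \<in> fin_supp \<and> ?N (\<lambda>x. \<phi> x - f k x) < inverse (real (Suc k)) \<and>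
      ?E (\<lambda>x. \<phi> x - f k x) < inverse (real (Suc k))" for k
  proof -
    obtain \<phi> where \<phi>: "\<And>n. \<phi> n \<in> fin_supp" "(\<lambda>n. ?N (\<lambda>x. \<phi> n x - f k x)) \<longlonglongrightarrow> 0"
      "(\<lambda>n. ?E (\<lambda>x. \<phi> n x - f k x)) \<longlonglongrightarrow> 0"
      using form_dom_approx[OF f] by blast
    have "\<forall>\<^sub>F n in sequentially. ?N (\<lambda>x. \<phi> n x - f k x) < inverse (real (Suc k)) \<and>
        ?E (\<lambda>x. \<phi> n x - f k x) < inverse (real (Suc k))"
      by (intro eventually_conj order_tendstoD(2)[OF \<phi>(2)] order_tendstoD(2)[OF \<phi>(3)]) simp_all
    then show ?thesis using \<phi>(1) eventually_happens'[OF sequentially_bot] by blast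
  qed
  then obtain \<phi> where \<phi>: "\<And>k. \<phi> k \<in> fin_supp"
    "\<And>k. ?N (\<lambda>x. \<phi> k x - f k x) < inverse (real (Suc k))"
    "\<And>k. ?E (\<lambda>x. \<phi> k x - f k x) < inverse (real (Suc k))" by metis
  have d: "\<phi> k \<in> form_dom b m" for k using \<phi>(1) fin_supp_subset_form_dom by blast
  have lim0: "(\<lambda>k. 2 * inverse (real (Suc k)) + 2 * p k) \<longlonglongrightarrow> 0" if "p \<longlonglongrightarrow> 0" for p
    using tendsto_add[OF tendsto_mult_left[OF LIMSEQ_inverse_real_of_nat, of 2] tendsto_mult_left[OF that, of 2]] by simp
  show ?thesis
  proof (rule form_domI[OF g \<phi>(1)])
    have "?N (\<lambda>x. \<phi> k x - g x) \<le> 2 * inverse (real (Suc k)) + 2 * ?N (\<lambda>x. f k x - g x)" for k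
      using vtx.wip_triangle[of "\<phi> k" "f k" g] form_dom_ell2[OF d[of k]] form_dom_ell2[OF f[of k]] g(1) \<phi>(2)[of k]
      by linarith
    then show "(\<lambda>k. ?N (\<lambda>x. \<phi> k x - g x)) \<longlonglongrightarrow> 0"
      by (intro tendsto_sandwich[OF _ _ tendsto_const lim0[OF lim(1)]]) (simp_all add: vtx.wip_self_nonneg)
    have "?E (\<lambda>x. \<phi> k x - g x) \<le> 2 * inverse (real (Suc k)) + 2 * ?E (\<lambda>x. f k x - g x)" for k
      using edg.wip_triangle[of "gradient (\<phi> k)" "gradient (f k)" "gradient g"]
        form_dom_gradient[OF d[of k]] form_dom_gradient[OF f[of k]] g(2) \<phi>(3)[of k]
      by (simp add: energy_eq gradient_diff finite_energy_eq)
    then show "(\<lambda>k. ?E (\<lambda>x. \<phi> k x - g x)) \<longlonglongrightarrow> 0"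
      by (intro tendsto_sandwich[OF _ _ tendsto_const lim0[OF lim(2)]]) (simp_all add: energy_self_nonneg)
  qed
qed

lemma fin_supp_form_dom: "f \<in> fin_supp \<Longrightarrow> f \<in> form_dom b m"
  using fin_supp_subset_form_dom by blast

lemma form_dom_diff:
  assumes f: "f \<in> form_dom b m" and g: "g \<in> form_dom b m"
  shows "(\<lambda>x. f x - g x) \<in> form_dom b m"
proof -
  let ?N = "\<lambda>f. wip m f f" and ?E = "\<lambda>f. energy b f f"
  obtain \<phi> where \<phi>: "\<And>n. \<phi> n \<in> fin_supp" "(\<lambda>n. ?N (\<lambda>x. \<phi> n x - f x)) \<longlonglongrightarrow> 0"
      "(\<lambda>n. ?E (\<lambda>x. \<phi> n x - f x)) \<longlonglongrightarrow> 0" using form_dom_approx[OF f] by blast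
  obtain \<psi> where \<psi>: "\<And>n. \<psi> n \<in> fin_supp" "(\<lambda>n. ?N (\<lambda>x. \<psi> n x - g x)) \<longlonglongrightarrow> 0"
      "(\<lambda>n. ?E (\<lambda>x. \<psi> n x - g x)) \<longlonglongrightarrow> 0" using form_dom_approx[OF g] by blast
  note mem = \<phi>(1)[THEN fin_supp_form_dom] \<psi>(1)[THEN fin_supp_form_dom] f g
  note mem = mem[THEN form_dom_ell2] mem[THEN form_dom_gradient]
  have lim0: "(\<lambda>k. 2 * p k + 2 * q k) \<longlonglongrightarrow> 0" if "p \<longlonglongrightarrow> 0" "q \<longlonglongrightarrow> 0" for p q :: "nat \<Rightarrow> real"
    using tendsto_add[OF tendsto_mult_left[OF that(1), of 2] tendsto_mult_left[OF that(2), of 2]] by simp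
  show ?thesis
  proof (rule form_domI)
    show "(\<lambda>x. f x - g x) \<in> wl2 m" using mem vtx.wl2_diff by blast
    show "(\<lambda>x. f x - g x) \<in> finite_energy b"
      using mem edg.wl2_diff by (simp add: finite_energy_eq gradient_diff)
    show "(\<lambda>x. \<phi> n x - \<psi> n x) \<in> fin_supp" for n
      using \<phi>(1)[of n] \<psi>(1)[of n] unfolding fin_supp_def mem_Collect_eq
      by (rule finite_subset[rotated, OF finite_UnI]) auto
    have eq: "(\<lambda>x. (\<phi> n x - \<psi> n x) - (f x - g x)) = (\<lambda>x. (\<phi> n x - f x) - (\<psi> n x - g x))" for n
      by auto
    have "?N (\<lambda>x. (\<phi> n x - \<psi> n x) - (f x - g x)) \<le> 2 * ?N (\<lambda>x. \<phi> n x - f x) + 2 * ?N (\<lambda>x. \<psi> n x - g x)" for n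
      unfolding eq by (intro vtx.wip_diff_self_le vtx.wl2_diff mem)
    then show "(\<lambda>n. ?N (\<lambda>x. (\<phi> n x - \<psi> n x) - (f x - g x))) \<longlonglongrightarrow> 0"
      by (intro tendsto_sandwich[OF _ _ tendsto_const lim0[OF \<phi>(2) \<psi>(2)]]) (simp_all add: vtx.wip_self_nonneg)
    have "?E (\<lambda>x. (\<phi> n x - \<psi> n x) - (f x - g x)) \<le> 2 * ?E (\<lambda>x. \<phi> n x - f x) + 2 * ?E (\<lambda>x. \<psi> n x - g x)" for n
      using edg.wip_diff_self_le[of "gradient (\<lambda>x. \<phi> n x - f x)" "gradient (\<lambda>x. \<psi> n x - g x)"] mem
      unfolding eq by (simp add: energy_eq gradient_diff edg.wl2_diff)
    then show "(\<lambda>n. ?E (\<lambda>x. (\<phi> n x - \<psi> n x) - (f x - g x))) \<longlonglongrightarrow> 0"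
      by (intro tendsto_sandwich[OF _ _ tendsto_const lim0[OF \<phi>(3) \<psi>(3)]]) (simp_all add: energy_self_nonneg)
  qed
qed

lemma energy_scale_left: "energy b (\<lambda>x. c * f x) g = c * energy b f g"
  and energy_scale_right: "energy b g (\<lambda>x. c * f x) = c * energy b g f"
  by (simp_all add: energy_eq gradient_scale edg.wip_scale_left edg.wip_scale_right)

lemma form_dom_scale:
  assumes f: "f \<in> form_dom b m"
  shows "(\<lambda>x. c * f x) \<in> form_dom b m"
proof -
  let ?N = "\<lambda>f. wip m f f" and ?E = "\<lambda>f. energy b f f"
  obtain \<phi> where \<phi>: "\<And>n. \<phi> n \<in> fin_supp" "(\<lambda>n. ?N (\<lambda>x. \<phi> n x - f x)) \<longlonglongrightarrow> 0"
      "(\<lambda>n. ?E (\<lambda>x. \<phi> n x - f x)) \<longlonglongrightarrow> 0" using form_dom_approx[OF f] by blast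
  have eq: "(\<lambda>x. c * \<phi> n x - c * f x) = (\<lambda>x. c * (\<phi> n x - f x))" for n
    by (simp add: right_diff_distrib)
  show ?thesis
  proof (rule form_domI)
    show "(\<lambda>x. c * f x) \<in> wl2 m" using f form_dom_ell2 vtx.wl2_scale by blast
    show "(\<lambda>x. c * f x) \<in> finite_energy b"
      using f form_dom_gradient edg.wl2_scale by (simp add: finite_energy_eq gradient_scale)
    show "(\<lambda>x. c * \<phi> n x) \<in> fin_supp" for n
      using \<phi>(1)[of n] unfolding fin_supp_def mem_Collect_eq by (rule finite_subset[rotated]) auto
    show "(\<lambda>n. ?N (\<lambda>x. c * \<phi> n x - c * f x)) \<longlonglongrightarrow> 0"
      using tendsto_mult_left[OF \<phi>(2), of "c * c"]
      unfolding eq by (simp add: vtx.wip_scale_left vtx.wip_scale_right mult.assoc)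
    show "(\<lambda>n. ?E (\<lambda>x. c * \<phi> n x - c * f x)) \<longlonglongrightarrow> 0"
      using tendsto_mult_left[OF \<phi>(3), of "c * c"]
      unfolding eq by (simp add: energy_scale_left energy_scale_right mult.assoc)
  qed
qed

lemma energy_diff_left:
  "f \<in> form_dom b m \<Longrightarrow> g \<in> form_dom b m \<Longrightarrow> h \<in> form_dom b m \<Longrightarrow>
    energy b (\<lambda>x. f x - g x) h = energy b f h - energy b g h"
  by (simp add: energy_eq gradient_diff edg.wip_diff_left form_dom_gradient)

lemma energy_diff_self:
  "f \<in> form_dom b m \<Longrightarrow> g \<in> form_dom b m \<Longrightarrow>
    energy b (\<lambda>x. f x - g x) (\<lambda>x. f x - g x) = energy b f f + energy b g g - 2 * energy b f g"
  by (simp add: energy_eq gradient_diff edg.wip_diff_self form_dom_gradient)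

lemma energy_diff_self_le:
  "f \<in> form_dom b m \<Longrightarrow> g \<in> form_dom b m \<Longrightarrow>
    energy b (\<lambda>x. f x - g x) (\<lambda>x. f x - g x) \<le> 2 * energy b f f + 2 * energy b g g"
  using edg.wip_diff_self_le[of "gradient f" "gradient g"]
  by (simp add: energy_eq gradient_diff form_dom_gradient)

lemma wip_fin_supp:
  assumes "finite F" "\<And>x. x \<notin> F \<Longrightarrow> h x = 0"
  shows "wip m g h = (\<Sum>x\<in>F. m x * g x * h x)"
proof -
  have "wip m g h = (\<Sum>\<^sub>\<infinity>x\<in>F. m x * g x * h x)"
    unfolding wip_def by (rule infsum_cong_neutral) (use assms in auto)
  then show ?thesis using assms by simp
qed

definition nbrs :: "'v \<Rightarrow> 'v set" where "nbrs x = {y. (x, y) \<in> edges b}"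

lemma finite_nbrs: "finite (nbrs x)"
  by (simp add: nbrs_def locally_finite)

lemma b_eq_0_off_nbrs: "y \<notin> nbrs x \<Longrightarrow> b x y = 0"
  using b_nonneg[of x y] by (auto simp: nbrs_def edges_def)

text \<open>
  If \<open>h\<close> vanishes off the interior of a finite set, no edge leaving the set contributes, whatever \<open>f\<close>
  is; in particular \<open>f\<close> may have infinite energy, as the function in the Hardy inequality might.
\<close>

lemma energy_eq_finite_sum:
  assumes S: "finite S" and supp: "\<And>x. h x \<noteq> 0 \<Longrightarrow> x \<in> S" "\<And>x. h x \<noteq> 0 \<Longrightarrow> nbrs x \<subseteq> S"
  shows "energy b f h = 1 / 2 * (\<Sum>x\<in>S. \<Sum>y\<in>S. b x y * (f x - f y) * (h x - h y))"
proof -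
  have out: "b x y * (h x - h y) = 0" if "(x, y) \<notin> S \<times> S" for x y
  proof (cases "h x = 0 \<and> h y = 0")
    case False
    have "b x y = 0"
    proof (rule ccontr)
      assume "b x y \<noteq> 0"
      then have "y \<in> nbrs x" "x \<in> nbrs y" using b_eq_0_off_nbrs[of y x] b_eq_0_off_nbrs[of x y] b_sym[of x y] by auto
      then show False using False that supp by blast
    qed
    then show ?thesis by simp
  qed simp
  have "(\<Sum>\<^sub>\<infinity>(x, y). b x y * (f x - f y) * (h x - h y)) = (\<Sum>\<^sub>\<infinity>(x, y)\<in>S \<times> S. b x y * (f x - f y) * (h x - h y))"
  proof (rule infsum_cong_neutral)
    fix p assume "p \<in> UNIV - S \<times> S"
    then have "b (fst p) (snd p) * (h (fst p) - h (snd p)) = 0" by (intro out) auto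
    then show "(case p of (x, y) \<Rightarrow> b x y * (f x - f y) * (h x - h y)) = 0"
      by (auto simp: case_prod_unfold)
  qed auto
  then show ?thesis using S by (simp add: energy_def sum.cartesian_product)
qed

lemma green_formula:
  assumes F: "finite F" and h: "\<And>x. x \<notin> F \<Longrightarrow> h x = 0"
  shows "energy b f h = (\<Sum>x\<in>F. h x * (\<Sum>y\<in>nbrs x. b x y * (f x - f y)))"
proof -
  define S where "S = F \<union> (\<Union>x\<in>F. nbrs x)"
  have S: "finite S" using F finite_nbrs by (auto simp: S_def)
  have supp: "x \<in> S" "nbrs x \<subseteq> S" if "h x \<noteq> 0" for x
    using that h[of x] by (auto simp: S_def)
  have "energy b f h = 1 / 2 * (\<Sum>x\<in>S. \<Sum>y\<in>S. b x y * (f x - f y) * (h x - h y))"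
    by (rule energy_eq_finite_sum[OF S]) (use supp in auto)
  also have "(\<Sum>x\<in>S. \<Sum>y\<in>S. b x y * (f x - f y) * (h x - h y))
      = (\<Sum>x\<in>S. \<Sum>y\<in>S. b x y * (f x - f y) * h x) + (\<Sum>x\<in>S. \<Sum>y\<in>S. b x y * (f y - f x) * h y)"
    by (simp add: sum.distrib[symmetric] algebra_simps)
  also have "(\<Sum>x\<in>S. \<Sum>y\<in>S. b x y * (f y - f x) * h y) = (\<Sum>x\<in>S. \<Sum>y\<in>S. b x y * (f x - f y) * h x)"
    by (subst sum.swap) (simp add: b_sym)
  finally have "energy b f h = (\<Sum>x\<in>S. \<Sum>y\<in>S. b x y * (f x - f y) * h x)"
    by simp
  also have "\<dots> = (\<Sum>x\<in>F. \<Sum>y\<in>S. b x y * (f x - f y) * h x)"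
    by (rule sum.mono_neutral_right) (use S h in \<open>auto simp: S_def\<close>)
  also have "\<dots> = (\<Sum>x\<in>F. \<Sum>y\<in>nbrs x. b x y * (f x - f y) * h x)"
    by (intro sum.cong refl sum.mono_neutral_right S) (auto simp: S_def b_eq_0_off_nbrs)
  also have "\<dots> = (\<Sum>x\<in>F. h x * (\<Sum>y\<in>nbrs x. b x y * (f x - f y)))"
    by (simp add: sum_distrib_left mult.commute)
  finally show ?thesis .
qed

end

section \<open>The operator of the form as a relation\<close>

context weighted_graph
begin

text \<open>
  The pair \<open>(f, g)\<close> lies in the graph of the operator. The relation avoids the definite description in
  the operator, and being closed under limits it is the form in which the operator is used below.
\<close>

definition has_laplacian :: "('v \<Rightarrow> real) \<Rightarrow> ('v \<Rightarrow> real) \<Rightarrow> bool" where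
  "has_laplacian f g \<longleftrightarrow> f \<in> form_dom b m \<and> g \<in> wl2 m \<and> (\<forall>h\<in>form_dom b m. energy b f h = wip m g h)"

lemma laplacian_iff: "f \<in> laplacian_dom b m \<and> laplacian b m f = g \<longleftrightarrow> has_laplacian f g"
proof
  assume "has_laplacian f g"
  then show "f \<in> laplacian_dom b m \<and> laplacian b m f = g"
    by (auto simp: has_laplacian_def laplacian_dom_def ell2_eq ell2_inner_eq intro!: laplacian_eqI)
next
  assume *: "f \<in> laplacian_dom b m \<and> laplacian b m f = g"
  then obtain g' where g': "has_laplacian f g'"
    by (auto simp: has_laplacian_def laplacian_dom_def ell2_eq ell2_inner_eq)
  then have "laplacian b m f = g'"
    by (auto simp: has_laplacian_def ell2_eq ell2_inner_eq intro!: laplacian_eqI)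
  with * g' show "has_laplacian f g" by simp
qed

lemma has_laplacian_diff:
  assumes "has_laplacian f g" "has_laplacian f' g'"
  shows "has_laplacian (\<lambda>x. f x - f' x) (\<lambda>x. g x - g' x)"
  using assms by (auto simp: has_laplacian_def form_dom_diff vtx.wl2_diff energy_diff_left vtx.wip_diff_left form_dom_ell2)

lemma has_laplacian_scale: "has_laplacian f g \<Longrightarrow> has_laplacian (\<lambda>x. c * f x) (\<lambda>x. c * g x)"
  by (auto simp: has_laplacian_def form_dom_scale vtx.wl2_scale energy_scale_left vtx.wip_scale_left)

lemma eigenspace_iff:
  "f \<in> eigenspace (laplacian_dom b m) (laplacian b m) \<mu> \<longleftrightarrow> has_laplacian f (\<lambda>x. \<mu> * f x)"
  using laplacian_iff[of f "\<lambda>x. \<mu> * f x"] by (simp add: eigenspace_def)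

lemma wip_self_eq_0: "f \<in> wl2 m \<Longrightarrow> wip m f f \<le> 0 \<Longrightarrow> f = (\<lambda>x. 0)"
proof
  fix x assume f: "f \<in> wl2 m" "wip m f f \<le> 0"
  have "m x * (f x)\<^sup>2 \<le> 0" using vtx.finite_sum_le_wip[OF f(1), of "{x}"] f(2) by simp
  then show "f x = 0" using m_pos[of x] by (simp add: mult_le_0_iff)
qed

text \<open>
  Convergence in \<open>\<ell>\<^sup>2\<close> of approximate solutions of \<open>L f = \<mu> f + g\<close> upgrades itself to
  convergence of the energy. Expanding \<open>Q(f\<^sub>k - f\<^sub>j, f\<^sub>k - f\<^sub>j)\<close> and using the equation for
  \<open>f\<^sub>k\<close> tested against \<open>f\<^sub>k\<close> and \<open>f\<^sub>j\<close> leaves only \<open>\<ell>\<^sup>2\<close> inner products, which converge. The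
  equation then passes to the limit, first for finitely supported \<open>h\<close> and then for all \<open>h\<close> by
  density. The equation is demanded for a test function only eventually in \<open>k\<close>, so that it covers
  Galerkin solutions on growing finite sets as well as exact eigenvectors.
\<close>

lemma has_laplacianI_limit:
  assumes f: "\<And>k. f k \<in> form_dom b m" "f' \<in> wl2 m" and g: "\<And>k. g k \<in> wl2 m" "g' \<in> wl2 m"
    and pointwise: "\<And>x. (\<lambda>k. f k x) \<longlonglongrightarrow> f' x"
    and lim_f: "(\<lambda>k. wip m (\<lambda>x. f k x - f' x) (\<lambda>x. f k x - f' x)) \<longlonglongrightarrow> 0"
    and lim_g: "(\<lambda>k. wip m (\<lambda>x. g k x - g' x) (\<lambda>x. g k x - g' x)) \<longlonglongrightarrow> 0"
    and diag: "\<And>k. energy b (f k) (f k) = \<mu> * wip m (f k) (f k) + wip m (g k) (f k)"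
    and weak: "\<And>h. h \<in> fin_supp \<union> range f \<Longrightarrow>
      \<forall>\<^sub>F k in sequentially. energy b (f k) h = \<mu> * wip m (f k) h + wip m (g k) h"
  shows "has_laplacian f' (\<lambda>x. \<mu> * f' x + g' x)"
proof -
  have fl: "f k \<in> wl2 m" for k using f form_dom_ell2 by blast
  have const: "(\<lambda>k. wip m (\<lambda>x. h x - h x) (\<lambda>x. h x - h x)) \<longlonglongrightarrow> 0" for h
    by (simp add: wip_def)
  have lim_fh: "(\<lambda>k. wip m (f k) h) \<longlonglongrightarrow> wip m f' h" and lim_gh: "(\<lambda>k. wip m (g k) h) \<longlonglongrightarrow> wip m g' h"
    if "h \<in> wl2 m" for h
    using vtx.wip_tendsto[where u = f and v = "\<lambda>k. h", OF fl f(2) that that lim_f const]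
      vtx.wip_tendsto[where u = g and v = "\<lambda>k. h", OF g that that lim_g const] by auto
  have lim_ff: "(\<lambda>k. wip m (f k) (f k)) \<longlonglongrightarrow> wip m f' f'" by (rule vtx.wip_tendsto[OF fl f(2) fl f(2) lim_f lim_f])
  have lim_gf: "(\<lambda>k. wip m (g k) (f k)) \<longlonglongrightarrow> wip m g' f'" by (rule vtx.wip_tendsto[OF g fl f(2) lim_g lim_f])
  have lim_hf: "(\<lambda>k. wip m h (f k)) \<longlonglongrightarrow> wip m h f'" if "h \<in> wl2 m" for h
    using lim_fh[OF that] by (simp only: wip_commute[of m h])
  \<comment> \<open>the limit of the energy of \<open>f k - f j\<close> as \<open>k\<close> grows\<close>
  define R where "R j = \<mu> * wip m f' f' + wip m g' f' + (\<mu> * wip m (f j) (f j) + wip m (g j) (f j))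
      - 2 * (\<mu> * wip m f' (f j) + wip m g' (f j))" for j
  have "(\<lambda>j. R j) \<longlonglongrightarrow> \<mu> * wip m f' f' + wip m g' f' + (\<mu> * wip m f' f' + wip m g' f')
      - 2 * (\<mu> * wip m f' f' + wip m g' f')"
    unfolding R_def
    by (intro tendsto_intros lim_ff lim_gf lim_hf f(2) g(2))
  then have R0: "R \<longlonglongrightarrow> 0" by simp
  have R: "(\<lambda>k. energy b (\<lambda>x. f k x - f j x) (\<lambda>x. f k x - f j x)) \<longlonglongrightarrow> R j" for j
  proof (rule Lim_transform_eventually)
    show "(\<lambda>k. (\<mu> * wip m (f k) (f k) + wip m (g k) (f k)) + (\<mu> * wip m (f j) (f j) + wip m (g j) (f j))
      - 2 * (\<mu> * wip m (f k) (f j) + wip m (g k) (f j))) \<longlonglongrightarrow> R j"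
      unfolding R_def by (intro tendsto_intros lim_ff lim_gf lim_fh lim_gh fl)
    have "\<forall>\<^sub>F k in sequentially. energy b (f k) (f j) = \<mu> * wip m (f k) (f j) + wip m (g k) (f j)"
      by (rule weak) auto
    then show "\<forall>\<^sub>F k in sequentially. (\<mu> * wip m (f k) (f k) + wip m (g k) (f k)) + (\<mu> * wip m (f j) (f j) + wip m (g j) (f j))
      - 2 * (\<mu> * wip m (f k) (f j) + wip m (g k) (f j)) = energy b (\<lambda>x. f k x - f j x) (\<lambda>x. f k x - f j x)"
      by eventually_elim (simp add: energy_diff_self[OF f(1) f(1)] diag)
  qed
  have cauchy: "\<forall>\<^sub>F j in sequentially. \<forall>\<^sub>F k in sequentially.
      wip (case_prod b) (\<lambda>i. gradient (f k) i - gradient (f j) i) (\<lambda>i. gradient (f k) i - gradient (f j) i) \<le> \<epsilon>"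
    if "\<epsilon> > 0" for \<epsilon>
  proof -
    have "\<forall>\<^sub>F j in sequentially. R j < \<epsilon> / 2" using that by (intro order_tendstoD(2)[OF R0]) simp
    then show ?thesis
    proof eventually_elim
      case (elim j)
      show ?case using order_tendstoD(2)[OF R elim]
        by eventually_elim (simp add: energy_eq gradient_diff)
    qed
  qed
  have grad_lim: "(\<lambda>k. gradient (f k) i) \<longlonglongrightarrow> gradient f' i" for i
    by (cases i) (auto simp: gradient_def intro!: tendsto_intros pointwise)
  note grad = edg.wip_cauchy_limit[of "\<lambda>k. gradient (f k)", OF form_dom_gradient[OF f(1)] grad_lim cauchy]
  have lim_E: "(\<lambda>k. energy b (\<lambda>x. f k x - f' x) (\<lambda>x. f k x - f' x)) \<longlonglongrightarrow> 0"
    using tendsto_mult_left[OF grad(2), of "1/2"] by (simp add: energy_eq gradient_diff)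
  have fD: "f' \<in> form_dom b m"
    by (rule form_dom_closed[OF f(1) f(2) _ lim_f lim_E]) (simp add: finite_energy_eq grad(1))
  have econst: "(\<lambda>k. energy b (\<lambda>x. h x - h x) (\<lambda>x. h x - h x)) \<longlonglongrightarrow> 0" for h
    by (simp add: energy_eq gradient_def wip_def)
  have eq: "energy b f' h = \<mu> * wip m f' h + wip m g' h" if h: "h \<in> fin_supp" for h
  proof (rule LIMSEQ_unique)
    note hD = fin_supp_form_dom[OF h]
    show "(\<lambda>k. energy b (f k) h) \<longlonglongrightarrow> energy b f' h"
      by (rule energy_tendsto[where u = f and v = "\<lambda>k. h", OF f(1) fD hD hD lim_E econst])
    have "(\<lambda>k. \<mu> * wip m (f k) h + wip m (g k) h) \<longlonglongrightarrow> \<mu> * wip m f' h + wip m g' h"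
      by (intro tendsto_intros lim_fh lim_gh form_dom_ell2 hD)
    moreover have "\<forall>\<^sub>F k in sequentially. \<mu> * wip m (f k) h + wip m (g k) h = energy b (f k) h"
      using weak[OF UnI1[OF h]] by eventually_elim simp
    ultimately show "(\<lambda>k. energy b (f k) h) \<longlonglongrightarrow> \<mu> * wip m f' h + wip m g' h"
      by (rule Lim_transform_eventually)
  qed
  have "energy b f' h = \<mu> * wip m f' h + wip m g' h" if h: "h \<in> form_dom b m" for h
  proof -
    obtain \<phi> where \<phi>: "\<And>n. \<phi> n \<in> fin_supp" "(\<lambda>n. wip m (\<lambda>x. \<phi> n x - h x) (\<lambda>x. \<phi> n x - h x)) \<longlonglongrightarrow> 0"
      "(\<lambda>n. energy b (\<lambda>x. \<phi> n x - h x) (\<lambda>x. \<phi> n x - h x)) \<longlonglongrightarrow> 0" using form_dom_approx[OF h] by blast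
    note \<phi>D = \<phi>(1)[THEN fin_supp_form_dom]
    have "(\<lambda>n. energy b f' (\<phi> n)) \<longlonglongrightarrow> energy b f' h"
      by (rule energy_tendsto[where u = "\<lambda>k. f'" and v = \<phi>, OF fD fD \<phi>D h econst \<phi>(3)])
    moreover have "(\<lambda>n. energy b f' (\<phi> n)) \<longlonglongrightarrow> \<mu> * wip m f' h + wip m g' h"
      unfolding eq[OF \<phi>(1)]
      by (intro tendsto_intros
          vtx.wip_tendsto[where u = "\<lambda>k. f'" and v = \<phi>, OF f(2) f(2) form_dom_ell2[OF \<phi>D] form_dom_ell2[OF h] const \<phi>(2)]
          vtx.wip_tendsto[where u = "\<lambda>k. g'" and v = \<phi>, OF g(2) g(2) form_dom_ell2[OF \<phi>D] form_dom_ell2[OF h] const \<phi>(2)])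
    ultimately show ?thesis by (rule LIMSEQ_unique)
  qed
  then show ?thesis
    using fD f(2) g(2) by (simp add: has_laplacian_def vtx.wl2_add vtx.wl2_scale vtx.wip_add_left vtx.wip_scale_left form_dom_ell2)
qed

end

section \<open>Two facts of finite-dimensional linear algebra\<close>

text \<open>
  Gaussian elimination: a square system with trivial kernel is solvable. One unknown \<open>p\<close> is
  eliminated by means of an equation \<open>q\<close> that contains it; rows and columns need separate index sets,
  because afterwards \<open>F - {q}\<close> and \<open>G\<close> have the same size but need not be equal.
\<close>

lemma square_system_solvable:
  fixes M :: "'i \<Rightarrow> 'j \<Rightarrow> real"
  assumes "finite G" "finite F" "card F = card G"
    and "\<And>f. (\<forall>x\<in>F. (\<Sum>y\<in>G. M x y * f y) = 0) \<Longrightarrow> \<forall>y\<in>G. f y = 0"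
  shows "\<exists>f. \<forall>x\<in>F. (\<Sum>y\<in>G. M x y * f y) = g x"
  using assms
proof (induction G arbitrary: F M g rule: finite_induct)
  case empty
  then show ?case by simp
next
  case (insert p G)
  have upd: "(\<Sum>y\<in>G. c y * (f(p := t)) y) = (\<Sum>y\<in>G. c y * f y)" for c f t
    using insert.hyps by (intro sum.cong) auto
  have "\<exists>q\<in>F. M q p \<noteq> 0"
  proof (rule ccontr)
    assume "\<not> (\<exists>q\<in>F. M q p \<noteq> 0)"
    then have z: "M x p = 0" if "x \<in> F" for x using that by blast
    have "\<forall>x\<in>F. (\<Sum>y\<in>insert p G. M x y * (if y = p then 1 else 0)) = 0"
    proof
      fix x assume "x \<in> F"
      have "(\<Sum>y\<in>G. M x y * (if y = p then 1 else 0)) = 0"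
        by (rule sum.neutral) (use insert.hyps in auto)
      then show "(\<Sum>y\<in>insert p G. M x y * (if y = p then 1 else 0)) = 0"
        using insert.hyps z[OF \<open>x \<in> F\<close>] by simp
    qed
    from insert.prems(3)[OF this] show False by auto
  qed
  then obtain q where q: "q \<in> F" "M q p \<noteq> 0" by blast
  define M' where "M' x y = M x y - M x p / M q p * M q y" for x y
  have M': "(\<Sum>y\<in>G. M' x y * f y) = (\<Sum>y\<in>G. M x y * f y) - M x p / M q p * (\<Sum>y\<in>G. M q y * f y)" for x f
    by (simp add: M'_def sum_distrib_left sum_subtractf algebra_simps)
  have "\<exists>f. \<forall>x\<in>F - {q}. (\<Sum>y\<in>G. M' x y * f y) = g x - M x p / M q p * g q"
  proof (rule insert.IH)
    show "finite (F - {q})" "card (F - {q}) = card G"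
      using insert.prems insert.hyps q by auto
    fix f assume f: "\<forall>x\<in>F - {q}. (\<Sum>y\<in>G. M' x y * f y) = 0"
    define t where "t = - (\<Sum>y\<in>G. M q y * f y) / M q p"
    have "\<forall>x\<in>F. (\<Sum>y\<in>insert p G. M x y * (f(p := t)) y) = 0"
    proof
      fix x assume "x \<in> F"
      then show "(\<Sum>y\<in>insert p G. M x y * (f(p := t)) y) = 0"
        using f q(2) insert.hyps upd[of "M x" f t]
        by (cases "x = q") (auto simp: M' t_def)
    qed
    from insert.prems(3)[OF this] show "\<forall>y\<in>G. f y = 0"
      using insert.hyps by (metis fun_upd_other insertI2)
  qed
  then obtain f where f: "\<forall>x\<in>F - {q}. (\<Sum>y\<in>G. M' x y * f y) = g x - M x p / M q p * g q" ..
  define t where "t = (g q - (\<Sum>y\<in>G. M q y * f y)) / M q p"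
  have "(\<Sum>y\<in>insert p G. M x y * (f(p := t)) y) = g x" if "x \<in> F" for x
  proof -
    have "(\<Sum>y\<in>insert p G. M x y * (f(p := t)) y) = M x p * t + (\<Sum>y\<in>G. M x y * f y)"
      using insert.hyps upd[of "M x" f t] by simp
    moreover have "M x p * t = M x p / M q p * g q - M x p / M q p * (\<Sum>y\<in>G. M q y * f y)"
      by (simp add: t_def diff_divide_distrib right_diff_distrib)
    moreover have "(\<Sum>y\<in>G. M x y * f y) - M x p / M q p * (\<Sum>y\<in>G. M q y * f y) = g x - M x p / M q p * g q"
      using f that q(2) by (cases "x = q") (auto simp: M')
    ultimately show ?thesis by simp
  qed
  then show ?case by blast
qed

text \<open>
  The restriction to a finite set \<open>F\<close> is then an injection into a space of dimension \<open>card F\<close>. The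
  induction removes a point \<open>p\<close> by passing to the functions vanishing there, which costs
  at most one dimension.
\<close>

lemma finite_dim_if_determined_on_finite:
  fixes E :: "('v \<Rightarrow> real) set"
  assumes "finite F" "\<And>f g c. f \<in> E \<Longrightarrow> g \<in> E \<Longrightarrow> (\<lambda>x. f x - c * g x) \<in> E"
    and "\<And>f. f \<in> E \<Longrightarrow> \<forall>x\<in>F. f x = 0 \<Longrightarrow> f = (\<lambda>x. 0)"
  shows "finite_dim E"
  using assms
proof (induction F arbitrary: E rule: finite_induct)
  case empty
  then show ?case unfolding finite_dim_def by (intro exI[of _ "{}"]) auto
next
  case (insert p F)
  let ?E = "{f \<in> E. f p = 0}"
  have "finite_dim ?E" using insert.prems by (intro insert.IH) auto
  then obtain B where B: "finite B" "B \<subseteq> ?E" "\<And>f. f \<in> ?E \<Longrightarrow> \<exists>c. f = (\<lambda>x. \<Sum>g\<in>B. c g * g x)"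
    unfolding finite_dim_def by blast
  show ?case
  proof (cases "E = ?E")
    case True
    with \<open>finite_dim ?E\<close> show ?thesis by simp
  next
    case False
    then obtain g where g: "g \<in> E" "g p \<noteq> 0" by blast
    have nB: "g \<notin> B" using B(2) g by auto
    have "\<exists>c. f = (\<lambda>x. \<Sum>h\<in>insert g B. c h * h x)" if f: "f \<in> E" for f
    proof -
      have "(\<lambda>x. f x - f p / g p * g x) \<in> ?E" using insert.prems(1)[OF f g(1), of "f p / g p"] g(2) by simp
      then obtain c where c: "(\<lambda>x. f x - f p / g p * g x) = (\<lambda>x. \<Sum>h\<in>B. c h * h x)" using B(3) by blast
      have "(\<Sum>h\<in>B. (c(g := f p / g p)) h * h x) = (\<Sum>h\<in>B. c h * h x)" for x
        using nB by (intro sum.cong) auto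
      then have "f x = (\<Sum>h\<in>insert g B. (c(g := f p / g p)) h * h x)" for x
        using fun_cong[OF c, of x] nB B(1) by simp
      then show ?thesis by blast
    qed
    then show ?thesis unfolding finite_dim_def using B g by (intro exI[of _ "insert g B"]) auto
  qed
qed

section \<open>Galerkin approximation\<close>

context weighted_graph
begin

text \<open>
  The equation \<open>L f - \<mu> f = g\<close> compressed to the functions that vanish off \<open>F\<close>.
\<close>

definition galerkin_solution :: "'v set \<Rightarrow> real \<Rightarrow> ('v \<Rightarrow> real) \<Rightarrow> ('v \<Rightarrow> real) \<Rightarrow> bool" where
  "galerkin_solution F \<mu> g f \<longleftrightarrow> (\<forall>x. x \<notin> F \<longrightarrow> f x = 0) \<and>
    (\<forall>h. (\<forall>x. x \<notin> F \<longrightarrow> h x = 0) \<longrightarrow> energy b f h = \<mu> * wip m f h + wip m g h)"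

text \<open>
  In the basis of point masses the problem is a square linear system, whose matrix \<open>M\<close> can be read off
  from Green's formula.
\<close>

lemma galerkin_solution_exists:
  assumes F: "finite F"
    and inj: "\<And>f. galerkin_solution F \<mu> (\<lambda>x. 0) f \<Longrightarrow> f = (\<lambda>x. 0)"
  shows "\<exists>f. galerkin_solution F \<mu> g f"
proof -
  define M where "M x y = (if x = y then (\<Sum>z\<in>nbrs x. b x z) - \<mu> * m x else 0) - b x y" for x y
  \<comment> \<open>extension by 0 of a vector indexed by \<open>F\<close>\<close>
  define res where "res f = (\<lambda>x. if x \<in> F then f x else (0::real))" for f
  have row: "(\<Sum>y\<in>F. M x y * f y) = (\<Sum>y\<in>nbrs x. b x y * (res f x - res f y)) - \<mu> * m x * res f x"
    if x: "x \<in> F" for x f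
  proof -
    have "(\<Sum>y\<in>F. b x y * f y) = (\<Sum>y\<in>F \<union> nbrs x. b x y * res f y)"
      by (rule sum.mono_neutral_cong_left) (auto simp: F finite_nbrs res_def)
    also have "\<dots> = (\<Sum>y\<in>nbrs x. b x y * res f y)"
      by (rule sum.mono_neutral_right) (auto simp: F finite_nbrs b_eq_0_off_nbrs)
    finally have *: "(\<Sum>y\<in>F. b x y * f y) = (\<Sum>y\<in>nbrs x. b x y * res f y)" .
    have "(\<Sum>y\<in>F. M x y * f y) = (\<Sum>y\<in>F. (if x = y then ((\<Sum>z\<in>nbrs x. b x z) - \<mu> * m x) * f y else 0)) - (\<Sum>y\<in>F. b x y * f y)"
      unfolding sum_subtractf[symmetric] by (intro sum.cong) (auto simp: M_def algebra_simps)
    also have "(\<Sum>y\<in>F. (if x = y then ((\<Sum>z\<in>nbrs x. b x z) - \<mu> * m x) * f y else 0))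
        = ((\<Sum>z\<in>nbrs x. b x z) - \<mu> * m x) * f x" using F x by simp
    finally have "(\<Sum>y\<in>F. M x y * f y) = ((\<Sum>z\<in>nbrs x. b x z) - \<mu> * m x) * f x - (\<Sum>y\<in>nbrs x. b x y * res f y)"
      unfolding * .
    moreover have "(\<Sum>y\<in>nbrs x. b x y * (res f x - res f y)) = (\<Sum>y\<in>nbrs x. b x y) * res f x - (\<Sum>y\<in>nbrs x. b x y * res f y)"
      by (simp only: right_diff_distrib sum_subtractf sum_distrib_right)
    moreover have "res f x = f x" using x by (simp add: res_def)
    ultimately show ?thesis by (simp add: left_diff_distrib)
  qed
  have form: "energy b (res f) h - \<mu> * wip m (res f) h = (\<Sum>x\<in>F. h x * (\<Sum>y\<in>F. M x y * f y))"
    if h: "\<And>x. x \<notin> F \<Longrightarrow> h x = 0" for f h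
  proof -
    have "energy b (res f) h - \<mu> * wip m (res f) h
        = (\<Sum>x\<in>F. h x * (\<Sum>y\<in>nbrs x. b x y * (res f x - res f y)) - \<mu> * (m x * res f x * h x))"
      by (simp only: green_formula[where F = F and h = h] wip_fin_supp[where F = F and h = h] F h
          sum_distrib_left[of \<mu>] sum_subtractf not_False_eq_True)
    also have "\<dots> = (\<Sum>x\<in>F. h x * (\<Sum>y\<in>F. M x y * f y))"
      by (intro sum.cong refl, subst row) (simp_all add: right_diff_distrib[of "h _"])
    finally show ?thesis .
  qed
  have "\<exists>f. \<forall>x\<in>F. (\<Sum>y\<in>F. M x y * f y) = m x * g x"
  proof (rule square_system_solvable[OF F F refl])
    fix f assume *: "\<forall>x\<in>F. (\<Sum>y\<in>F. M x y * f y) = 0"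
    have "res f = (\<lambda>x. 0)"
    proof (rule inj)
      show "galerkin_solution F \<mu> (\<lambda>x. 0) (res f)"
        unfolding galerkin_solution_def
      proof (intro conjI allI impI)
        show "res f x = 0" if "x \<notin> F" for x using that by (simp add: res_def)
        show "energy b (res f) h = \<mu> * wip m (res f) h + wip m (\<lambda>x. 0) h" if "\<forall>x. x \<notin> F \<longrightarrow> h x = 0" for h
          using form[of h f] * that by (simp add: wip_def[of m "\<lambda>x. 0"])
      qed
    qed
    then show "\<forall>y\<in>F. f y = 0" by (metis res_def)
  qed
  then obtain f where f: "\<forall>x\<in>F. (\<Sum>y\<in>F. M x y * f y) = m x * g x" ..
  have "galerkin_solution F \<mu> g (res f)"
    unfolding galerkin_solution_def
  proof (intro conjI allI impI)
    show "res f x = 0" if "x \<notin> F" for x using that by (simp add: res_def)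
    show "energy b (res f) h = \<mu> * wip m (res f) h + wip m g h" if h: "\<forall>x. x \<notin> F \<longrightarrow> h x = 0" for h
      using form[of h f] f wip_fin_supp[of F h g] F h by (simp add: mult.commute)
  qed
  then show ?thesis by blast
qed

lemma finite_exhaustion:
  obtains X :: "nat \<Rightarrow> 'v set" where "\<And>k. finite (X k)" "\<And>h. h \<in> fin_supp \<Longrightarrow> \<forall>\<^sub>F k in sequentially. \<forall>x. x \<notin> X k \<longrightarrow> h x = (0::real)"
proof
  define X where "X k = from_nat_into (UNIV :: 'v set) ` {..k}" for k
  show "finite (X k)" for k by (simp add: X_def)
  fix h :: "'v \<Rightarrow> real" assume h: "h \<in> fin_supp"
  define N where "N = Max (to_nat_on (UNIV :: 'v set) ` {x. h x \<noteq> 0})"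
  have "h x = 0" if "x \<notin> X k" "k \<ge> N" for x k
  proof (rule ccontr)
    assume "h x \<noteq> 0"
    then have "to_nat_on UNIV x \<le> N" using h by (auto simp: N_def fin_supp_def intro!: Max_ge)
    moreover have "x = from_nat_into UNIV (to_nat_on UNIV x)" using countable_vertices by simp
    ultimately show False using that by (auto simp: X_def image_iff)
  qed
  then show "\<forall>\<^sub>F k in sequentially. \<forall>x. x \<notin> X k \<longrightarrow> h x = 0"
    unfolding eventually_sequentially by blast
qed

end

section \<open>Tight forms have discrete spectrum\<close>

text \<open>
  Sets of bounded energy have uniformly small mass off a finite set. Since bounded subsets of a
  finite-dimensional space are relatively compact, this makes the embedding of the form
  domain into \<open>\<ell>\<^sup>2\<close> compact.
\<close>

locale tight_form = weighted_graph b m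
  for b :: "'v \<Rightarrow> 'v \<Rightarrow> real" and m :: "'v \<Rightarrow> real" +
  assumes tight: "\<epsilon> > 0 \<Longrightarrow> \<exists>F. finite F \<and>
    (\<forall>f\<in>form_dom b m. wip m f f \<le> (\<Sum>x\<in>F. m x * (f x)\<^sup>2) + \<epsilon> * energy b f f)"
begin

text \<open>
  A diagonal subsequence converges pointwise, hence in norm on each finite set; tightness
  controls the rest.
\<close>

lemma bounded_energy_subsequence:
  assumes f: "\<And>k. f k \<in> form_dom b m" and E: "\<And>k. energy b (f k) (f k) \<le> C" and K: "\<And>k. wip m (f k) (f k) \<le> K"
  obtains s f' where "strict_mono (s :: nat \<Rightarrow> nat)" "f' \<in> wl2 m" "\<And>x. (\<lambda>k. f (s k) x) \<longlonglongrightarrow> f' x"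
    "(\<lambda>k. wip m (\<lambda>x. f (s k) x - f' x) (\<lambda>x. f (s k) x - f' x)) \<longlonglongrightarrow> 0"
proof -
  \<comment> \<open>The factor \<open>sqrt (m x)\<close> makes the pointwise bound independent of \<open>x\<close>.\<close>
  have bounded: "norm (sqrt (m x) * f k x) \<le> sqrt K" for k x
  proof -
    have "m x * (f k x)\<^sup>2 \<le> K"
      using vtx.finite_sum_le_wip[OF form_dom_ell2[OF f[of k]], of "{x}"] K[of k] by simp
    then have "sqrt (m x * (f k x)\<^sup>2) \<le> sqrt K" by (rule real_sqrt_le_mono)
    then show ?thesis using m_pos[of x] by (simp add: real_sqrt_mult abs_mult)
  qed
  obtain s where s: "strict_mono (s :: nat \<Rightarrow> nat)" "\<And>x. \<exists>l. (\<lambda>k. sqrt (m x) * f (s k) x) \<longlonglongrightarrow> l"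
    by (rule function_convergent_subsequence[OF countable_vertices, of "\<lambda>k x. sqrt (m x) * f k x" "sqrt K"])
       (use bounded in auto)
  have "\<exists>l. (\<lambda>k. f (s k) x) \<longlonglongrightarrow> l" for x
  proof -
    obtain l where "(\<lambda>k. sqrt (m x) * f (s k) x) \<longlonglongrightarrow> l" using s(2) by blast
    from tendsto_mult_left[OF this, of "1 / sqrt (m x)"]
    show ?thesis using m_pos[of x] by auto
  qed
  then obtain f' where f': "\<And>x. (\<lambda>k. f (s k) x) \<longlonglongrightarrow> f' x" by metis
  have C: "C \<ge> 0" using order_trans[OF energy_self_nonneg E] .
  have cauchy: "\<forall>\<^sub>F j in sequentially. \<forall>\<^sub>F k in sequentially.
      wip m (\<lambda>x. f (s k) x - f (s j) x) (\<lambda>x. f (s k) x - f (s j) x) \<le> \<epsilon>" if \<epsilon>: "\<epsilon> > 0" for \<epsilon>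
  proof -
    \<comment> \<open>The differences have energy at most \<open>4 * C\<close>, so this tolerance costs at most half of \<open>\<epsilon>\<close>.\<close>
    obtain F where F: "finite F" "\<And>h. h \<in> form_dom b m \<Longrightarrow>
        wip m h h \<le> (\<Sum>x\<in>F. m x * (h x)\<^sup>2) + \<epsilon> / (8 * (C + 1)) * energy b h h"
      using tight[of "\<epsilon> / (8 * (C + 1))"] \<epsilon> C by auto
    have lim_k: "(\<lambda>k. \<Sum>x\<in>F. m x * (f (s k) x - f (s j) x)\<^sup>2) \<longlonglongrightarrow> (\<Sum>x\<in>F. m x * (f' x - f (s j) x)\<^sup>2)" for j
      by (intro tendsto_intros f')
    have "(\<lambda>j. \<Sum>x\<in>F. m x * (f' x - f (s j) x)\<^sup>2) \<longlonglongrightarrow> (\<Sum>x\<in>F. m x * (f' x - f' x)\<^sup>2)"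
      by (intro tendsto_intros f')
    then have "\<forall>\<^sub>F j in sequentially. (\<Sum>x\<in>F. m x * (f' x - f (s j) x)\<^sup>2) < \<epsilon> / 2"
      using \<epsilon> by (intro order_tendstoD(2)) auto
    then show ?thesis
    proof eventually_elim
      case (elim j)
      show ?case using order_tendstoD(2)[OF lim_k elim]
      proof eventually_elim
        case (elim k)
        let ?h = "\<lambda>x. f (s k) x - f (s j) x"
        have "energy b ?h ?h \<le> 2 * C + 2 * C"
          by (rule order_trans[OF energy_diff_self_le[OF f f]]) (intro add_mono mult_left_mono E, simp_all)
        then have "energy b ?h ?h \<le> 4 * (C + 1)" by simp
        then have "\<epsilon> / (8 * (C + 1)) * energy b ?h ?h \<le> \<epsilon> / (8 * (C + 1)) * (4 * (C + 1))"
          by (rule mult_left_mono) (use \<epsilon> C in simp)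
        also have "\<dots> = \<epsilon> / 2" using C by (simp add: field_simps)
        finally have A: "\<epsilon> / (8 * (C + 1)) * energy b ?h ?h \<le> \<epsilon> / 2" .
        have "wip m ?h ?h \<le> \<epsilon> / 2 + \<epsilon> / 2"
          by (rule order_trans[OF F(2)[OF form_dom_diff[OF f f]] add_mono[OF less_imp_le[OF elim] A]])
        then show ?case by simp
      qed
    qed
  qed
  note lim = vtx.wip_cauchy_limit[of "\<lambda>k. f (s k)", OF form_dom_ell2[OF f] f' cauchy]
  show ?thesis by (rule that[OF s(1) lim(1) f' lim(2)])
qed

text \<open>
  The equation tested against \<open>f\<^sub>k\<close> itself bounds the energy of \<open>f\<^sub>k\<close>, which provides the compactness
  needed to apply the closure of the operator.
\<close>

lemma has_laplacian_subsequence: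
  assumes f: "\<And>k. f k \<in> form_dom b m" and g: "\<And>k. g k \<in> wl2 m" "g' \<in> wl2 m"
    and bound: "\<And>k. wip m (f k) (f k) \<le> K"
    and lim_g: "(\<lambda>k. wip m (\<lambda>x. g k x - g' x) (\<lambda>x. g k x - g' x)) \<longlonglongrightarrow> 0"
    and diag: "\<And>k. energy b (f k) (f k) = \<mu> * wip m (f k) (f k) + wip m (g k) (f k)"
    and weak: "\<And>h. h \<in> fin_supp \<union> range f \<Longrightarrow>
      \<forall>\<^sub>F k in sequentially. energy b (f k) h = \<mu> * wip m (f k) h + wip m (g k) h"
  obtains s f' where "strict_mono (s :: nat \<Rightarrow> nat)" "has_laplacian f' (\<lambda>x. \<mu> * f' x + g' x)"
    "\<And>h. h \<in> wl2 m \<Longrightarrow> (\<lambda>k. wip m (f (s k)) h) \<longlonglongrightarrow> wip m f' h"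
    "(\<lambda>k. wip m (f (s k)) (f (s k))) \<longlonglongrightarrow> wip m f' f'"
proof -
  have "Bseq (\<lambda>k. wip m (g k) (g k))"
    using vtx.wip_tendsto[OF g g lim_g lim_g] by (intro convergent_imp_Bseq) (auto simp: convergent_def)
  then obtain G where G: "\<And>k. wip m (g k) (g k) \<le> G" unfolding Bseq_def by (metis abs_le_D1 real_norm_def)
  have fl: "f k \<in> wl2 m" for k using f form_dom_ell2 by blast
  have E: "energy b (f k) (f k) \<le> \<bar>\<mu>\<bar> * K + (G + K)" for k
  proof -
    have "2 * wip m (g k) (f k) \<le> wip m (g k) (g k) + wip m (f k) (f k)"
      using vtx.wip_self_nonneg[of "\<lambda>x. g k x - f k x"] vtx.wip_diff_self[OF g(1) fl, of k k] by simp
    moreover have "\<mu> * wip m (f k) (f k) \<le> \<bar>\<mu>\<bar> * K"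
      using bound[of k] vtx.wip_self_nonneg[of "f k"] by (intro mult_mono) auto
    moreover have "wip m (g k) (g k) + wip m (f k) (f k) \<le> G + K" by (intro add_mono G bound)
    moreover have "G + K \<ge> 0"
      using order_trans[OF vtx.wip_self_nonneg G] order_trans[OF vtx.wip_self_nonneg bound] by (rule add_nonneg_nonneg)
    ultimately show ?thesis unfolding diag by (intro add_mono) simp_all
  qed
  obtain s f' where s: "strict_mono (s :: nat \<Rightarrow> nat)" and f': "f' \<in> wl2 m" "\<And>x. (\<lambda>k. f (s k) x) \<longlonglongrightarrow> f' x"
    and lim: "(\<lambda>k. wip m (\<lambda>x. f (s k) x - f' x) (\<lambda>x. f (s k) x - f' x)) \<longlonglongrightarrow> 0"
    by (rule bounded_energy_subsequence[where f = f, OF f E bound], rule that; simp)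
  have sub: "filterlim s sequentially sequentially" using s by (rule filterlim_subseq)
  have "has_laplacian f' (\<lambda>x. \<mu> * f' x + g' x)"
  proof (rule has_laplacianI_limit[where f = "\<lambda>k. f (s k)" and g = "\<lambda>k. g (s k)", OF f f'(1) g f'(2) lim _ diag])
    show "(\<lambda>k. wip m (\<lambda>x. g (s k) x - g' x) (\<lambda>x. g (s k) x - g' x)) \<longlonglongrightarrow> 0"
      using filterlim_compose[OF lim_g sub] .
    fix h assume "h \<in> fin_supp \<union> range (\<lambda>k. f (s k))"
    then have "h \<in> fin_supp \<union> range f" by auto
    from weak[OF this] show "\<forall>\<^sub>F k in sequentially. energy b (f (s k)) h = \<mu> * wip m (f (s k)) h + wip m (g (s k)) h"
      by (rule eventually_compose_filterlim) (rule sub)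
  qed
  moreover have "(\<lambda>k. wip m (f (s k)) h) \<longlonglongrightarrow> wip m f' h" if "h \<in> wl2 m" for h
    by (rule vtx.wip_tendsto[where u = "\<lambda>k. f (s k)" and v = "\<lambda>k. h", OF fl f'(1) that that lim]) (simp add: wip_def)
  moreover have "(\<lambda>k. wip m (f (s k)) (f (s k))) \<longlonglongrightarrow> wip m f' f'"
    by (rule vtx.wip_tendsto[where u = "\<lambda>k. f (s k)" and v = "\<lambda>k. f (s k)", OF fl f'(1) fl f'(1) lim lim])
  ultimately show ?thesis using that s by blast
qed

text \<open>
  If the bound failed for every constant, normalised counterexamples would have right-hand sides of
  norm tending to 0, and their limit would be an eigenvector of norm 1. This holds on all finite sets
  containing \<open>F0\<close>; on small ones \<open>\<mu>\<close> may well be an eigenvalue of the compressed problem.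
\<close>

lemma galerkin_bound:
  assumes no_eigen: "\<And>f. has_laplacian f (\<lambda>x. \<mu> * f x) \<Longrightarrow> f = (\<lambda>x. 0)"
  shows "\<exists>C F0. finite F0 \<and> (\<forall>F f g. finite F \<and> F0 \<subseteq> F \<and> g \<in> wl2 m \<and> galerkin_solution F \<mu> g f \<longrightarrow>
      wip m f f \<le> C * wip m g g)"
proof -
  obtain X :: "nat \<Rightarrow> 'v set" where X: "\<And>k. finite (X k)"
    "\<And>h. h \<in> fin_supp \<Longrightarrow> \<forall>\<^sub>F k in sequentially. \<forall>x. x \<notin> X k \<longrightarrow> h x = 0" by (rule finite_exhaustion) auto
  define bad where "bad k F f g \<longleftrightarrow> finite F \<and> X k \<subseteq> F \<and> g \<in> wl2 m \<and> galerkin_solution F \<mu> g f \<and>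
      \<not> wip m f f \<le> real (Suc k) * wip m g g" for k F f g
  have "\<exists>k. \<forall>F f g. \<not> bad k F f g"
  proof (rule ccontr)
    assume "\<nexists>k. \<forall>F f g. \<not> bad k F f g"
    then obtain F f g where bad: "\<And>k. bad k (F k) (f k) (g k)" by metis
    then have F: "\<And>k. finite (F k)" "\<And>k. X k \<subseteq> F k" and g: "\<And>k. g k \<in> wl2 m"
      and sol: "\<And>k. galerkin_solution (F k) \<mu> (g k) (f k)"
      and gt: "\<And>k. wip m (f k) (f k) > real (Suc k) * wip m (g k) (g k)" unfolding bad_def not_le by blast+
    have f0: "f k x = 0" if "x \<notin> F k" for k x using sol[of k] that by (auto simp: galerkin_solution_def)
    have eq: "energy b (f k) h = \<mu> * wip m (f k) h + wip m (g k) h" if "\<And>x. x \<notin> F k \<Longrightarrow> h x = 0" for k h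
      using sol[of k] that by (auto simp: galerkin_solution_def)
    have pos: "wip m (f k) (f k) > 0" for k
      using gt[of k] vtx.wip_self_nonneg[of "g k"] by (smt (verit) mult_nonneg_nonneg of_nat_0_le_iff)
    define c where "c k = 1 / sqrt (wip m (f k) (f k))" for k
    have cc: "c k * c k = 1 / wip m (f k) (f k)" for k using pos[of k] by (simp add: c_def)
    let ?f = "\<lambda>k x. c k * f k x" and ?g = "\<lambda>k x. c k * g k x"
    have supp: "?f k x = 0" if "x \<notin> F k" for k x using f0[OF that] by simp
    have fs: "?f k \<in> fin_supp" for k
      unfolding fin_supp_def mem_Collect_eq by (rule finite_subset[OF _ F(1)[of k]]) (use supp in blast)
    have one: "wip m (?f k) (?f k) = 1" for k
      using pos[of k] cc[of k] by (simp add: vtx.wip_scale_left vtx.wip_scale_right mult.assoc[symmetric])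
    have small: "wip m (?g k) (?g k) \<le> inverse (real (Suc k))" for k
    proof -
      have "wip m (?g k) (?g k) = wip m (g k) (g k) / wip m (f k) (f k)"
        using cc[of k] by (simp add: vtx.wip_scale_left vtx.wip_scale_right mult.assoc[symmetric])
      also have "\<dots> \<le> inverse (real (Suc k))"
        using gt[of k] pos[of k] by (simp add: field_simps)
      finally show ?thesis .
    qed
    have eq': "energy b (?f k) h = \<mu> * wip m (?f k) h + wip m (?g k) h" if "\<And>x. x \<notin> F k \<Longrightarrow> h x = 0" for k h
      using eq[OF that] by (simp add: energy_scale_left vtx.wip_scale_left algebra_simps)
    have weak: "\<forall>\<^sub>F k in sequentially. energy b (?f k) h = \<mu> * wip m (?f k) h + wip m (?g k) h" if "h \<in> fin_supp" for h
      using X(2)[OF that] by eventually_elim (intro eq', use F(2) in blast)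
    obtain s f' where s: "strict_mono (s :: nat \<Rightarrow> nat)" and f': "has_laplacian f' (\<lambda>x. \<mu> * f' x + 0)"
      and lim: "(\<lambda>k. wip m (?f (s k)) (?f (s k))) \<longlonglongrightarrow> wip m f' f'"
    proof (rule has_laplacian_subsequence[where f = ?f and g = ?g and g' = "\<lambda>x. 0" and K = 1 and \<mu> = \<mu>])
      show "?f k \<in> form_dom b m" for k using fs fin_supp_form_dom by blast
      show "?g k \<in> wl2 m" for k using g vtx.wl2_scale by blast
      show "(\<lambda>x. 0) \<in> wl2 m" by (simp add: wl2_def)
      show "wip m (?f k) (?f k) \<le> 1" for k using one by simp
      show "(\<lambda>k. wip m (\<lambda>x. ?g k x - 0) (\<lambda>x. ?g k x - 0)) \<longlonglongrightarrow> 0"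
        by (rule tendsto_sandwich[OF _ _ tendsto_const LIMSEQ_inverse_real_of_nat])
           (use small vtx.wip_self_nonneg in auto)
      show "energy b (?f k) (?f k) = \<mu> * wip m (?f k) (?f k) + wip m (?g k) (?f k)" for k
        by (rule eq') (rule supp)
      show "\<forall>\<^sub>F k in sequentially. energy b (?f k) h = \<mu> * wip m (?f k) h + wip m (?g k) h"
        if "h \<in> fin_supp \<union> range ?f" for h
        using that fs weak by blast
    qed blast
    have "f' = (\<lambda>x. 0)" using no_eigen f' by simp
    then have "wip m f' f' = 0" by (simp add: wip_def)
    then show False using LIMSEQ_unique[OF lim, of 1] by (simp add: one)
  qed
  then obtain k where "\<forall>F f g. \<not> bad k F f g" ..
  then show ?thesis using X(1)[of k] unfolding bad_def by blast
qed

text \<open>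
  The Galerkin bound with \<open>g = 0\<close> is uniqueness for the finite problems, hence existence. With the
  given \<open>g\<close> it bounds the solutions, so they subconverge, and the bound survives in the limit.
\<close>

lemma resolvent_exists:
  assumes no_eigen: "\<And>f. has_laplacian f (\<lambda>x. \<mu> * f x) \<Longrightarrow> f = (\<lambda>x. 0)"
  shows "\<exists>C. \<forall>g\<in>wl2 m. \<exists>f. has_laplacian f (\<lambda>x. \<mu> * f x + g x) \<and> wip m f f \<le> C * wip m g g"
proof -
  have "\<exists>C F0. finite F0 \<and> (\<forall>F f g. finite F \<and> F0 \<subseteq> F \<and> g \<in> wl2 m \<and> galerkin_solution F \<mu> g f \<longrightarrow>
      wip m f f \<le> C * wip m g g)"
    by (rule galerkin_bound) (rule no_eigen)
  then obtain C where "\<exists>F0. finite F0 \<and> (\<forall>F f g. finite F \<and> F0 \<subseteq> F \<and> g \<in> wl2 m \<and>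
      galerkin_solution F \<mu> g f \<longrightarrow> wip m f f \<le> C * wip m g g)" ..
  then obtain F0 where *: "finite F0 \<and> (\<forall>F f g. finite F \<and> F0 \<subseteq> F \<and> g \<in> wl2 m \<and>
      galerkin_solution F \<mu> g f \<longrightarrow> wip m f f \<le> C * wip m g g)" ..
  then have F0: "finite F0" ..
  have bound: "wip m f f \<le> C * wip m g g"
    if "finite F" "F0 \<subseteq> F" "g \<in> wl2 m" "galerkin_solution F \<mu> g f" for F f g
    using * that by simp
  obtain X :: "nat \<Rightarrow> 'v set" where X: "\<And>k. finite (X k)"
    "\<And>h. h \<in> fin_supp \<Longrightarrow> \<forall>\<^sub>F k in sequentially. \<forall>x. x \<notin> X k \<longrightarrow> h x = 0" by (rule finite_exhaustion) auto
  have zero: "(\<lambda>x. 0) \<in> wl2 m" by (simp add: wl2_def)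
  have "\<exists>f. has_laplacian f (\<lambda>x. \<mu> * f x + g x) \<and> wip m f f \<le> C * wip m g g" if g: "g \<in> wl2 m" for g
  proof -
    have "\<exists>f. galerkin_solution (F0 \<union> X k) \<mu> g f" for k
    proof (rule galerkin_solution_exists)
      show fin: "finite (F0 \<union> X k)" using F0 X by simp
      fix f assume f: "galerkin_solution (F0 \<union> X k) \<mu> (\<lambda>x. 0) f"
      have "f \<in> fin_supp"
        unfolding fin_supp_def mem_Collect_eq
        by (rule finite_subset[OF _ fin]) (use f in \<open>auto simp: galerkin_solution_def\<close>)
      moreover have "wip m f f \<le> C * wip m (\<lambda>x. 0) (\<lambda>x. 0)"
        by (rule bound[OF fin _ zero f]) simp
      ultimately show "f = (\<lambda>x. 0)"
        by (intro wip_self_eq_0 form_dom_ell2 fin_supp_form_dom) (auto simp: wip_def[of _ "\<lambda>x. 0"])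
    qed
    then obtain f where sol: "\<And>k. galerkin_solution (F0 \<union> X k) \<mu> g (f k)" by metis
    have supp: "f k x = 0" if "x \<notin> F0 \<union> X k" for k x using sol[of k] that by (auto simp: galerkin_solution_def)
    have eq: "energy b (f k) h = \<mu> * wip m (f k) h + wip m g h" if "\<And>x. x \<notin> F0 \<union> X k \<Longrightarrow> h x = 0" for k h
      using sol[of k] that by (auto simp: galerkin_solution_def)
    have fs: "f k \<in> fin_supp" for k
      unfolding fin_supp_def mem_Collect_eq by (rule finite_subset[of _ "F0 \<union> X k"]) (use F0 X supp in auto)
    have le: "wip m (f k) (f k) \<le> C * wip m g g" for k
      by (rule bound[OF _ _ g sol[of k]]) (use F0 X in auto)
    have weak: "\<forall>\<^sub>F k in sequentially. energy b (f k) h = \<mu> * wip m (f k) h + wip m g h" if "h \<in> fin_supp" for h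
      using X(2)[OF that] by eventually_elim (intro eq, blast)
    obtain s f' where s: "strict_mono (s :: nat \<Rightarrow> nat)" and f': "has_laplacian f' (\<lambda>x. \<mu> * f' x + g x)"
      and lim: "(\<lambda>k. wip m (f (s k)) (f (s k))) \<longlonglongrightarrow> wip m f' f'"
    proof (rule has_laplacian_subsequence[where f = f and g = "\<lambda>k. g" and g' = g and \<mu> = \<mu>])
      show "f k \<in> form_dom b m" for k using fs fin_supp_form_dom by blast
      show "(\<lambda>k. wip m (\<lambda>x. g x - g x) (\<lambda>x. g x - g x)) \<longlonglongrightarrow> 0" by (simp add: wip_def)
      show "energy b (f k) (f k) = \<mu> * wip m (f k) (f k) + wip m g (f k)" for k
        by (rule eq) (rule supp)
      show "\<forall>\<^sub>F k in sequentially. energy b (f k) h = \<mu> * wip m (f k) h + wip m g h"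
        if "h \<in> fin_supp \<union> range f" for h
        using that fs weak by blast
    qed (use g le in blast)+
    have "wip m f' f' \<le> C * wip m g g"
      by (rule tendsto_upperbound[OF lim]) (use le in auto)
    then show ?thesis using f' by blast
  qed
  then show ?thesis by blast
qed

text \<open>
  Without an eigenvector, the solutions found above are unique, so they form a bounded inverse
  and \<open>\<mu>\<close> lies in the resolvent set.
\<close>

lemma spectrum_eigenvalue:
  assumes "\<mu> \<in> spectrum m (laplacian_dom b m) (laplacian b m)"
  obtains f where "has_laplacian f (\<lambda>x. \<mu> * f x)" "wip m f f = 1"
proof -
  let ?D = "laplacian_dom b m" and ?T = "laplacian b m"
  have "\<exists>f. has_laplacian f (\<lambda>x. \<mu> * f x) \<and> f \<noteq> (\<lambda>x. 0)"
  proof (rule ccontr)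
    assume "\<nexists>f. has_laplacian f (\<lambda>x. \<mu> * f x) \<and> f \<noteq> (\<lambda>x. 0)"
    then have no_eigen: "\<And>f. has_laplacian f (\<lambda>x. \<mu> * f x) \<Longrightarrow> f = (\<lambda>x. 0)" by blast
    have "\<exists>C. \<forall>g\<in>wl2 m. \<exists>f. has_laplacian f (\<lambda>x. \<mu> * f x + g x) \<and> wip m f f \<le> C * wip m g g"
      by (rule resolvent_exists) (rule no_eigen)
    then obtain C where C: "\<forall>g\<in>wl2 m. \<exists>f. has_laplacian f (\<lambda>x. \<mu> * f x + g x) \<and> wip m f f \<le> C * wip m g g" ..
    let ?R = "\<lambda>f x. ?T f x - \<mu> * f x"
    have T: "has_laplacian f (\<lambda>x. \<mu> * f x + ?R f x)" if "f \<in> ?D" for f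
      using laplacian_iff[of f "?T f"] that by simp
    have R: "?R f = g" if "has_laplacian f (\<lambda>x. \<mu> * f x + g x)" for f g
      using laplacian_iff[of f "\<lambda>x. \<mu> * f x + g x"] that by simp
    have unique: "f = f'" if "has_laplacian f (\<lambda>x. \<mu> * f x + g x)" "has_laplacian f' (\<lambda>x. \<mu> * f' x + g x)" for f f' g
    proof -
      have "has_laplacian (\<lambda>x. f x - f' x) (\<lambda>x. \<mu> * (f x - f' x))"
        using has_laplacian_diff[OF that] by (simp add: right_diff_distrib)
      from fun_cong[OF no_eigen[OF this]] show ?thesis by auto
    qed
    have Rl2: "?R f \<in> wl2 m" if "f \<in> ?D" for f
      using T[OF that] vtx.wl2_diff[of "\<lambda>x. \<mu> * f x + ?R f x" "\<lambda>x. \<mu> * f x"] vtx.wl2_scale[of f \<mu>]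
      by (auto simp: has_laplacian_def form_dom_ell2)
    have "bij_betw ?R ?D (ell2 m)"
    proof (rule bij_betw_imageI)
      show "inj_on ?R ?D"
      proof (rule inj_onI)
        fix f f' assume "f \<in> ?D" "f' \<in> ?D" "?R f = ?R f'"
        then show "f = f'" using T[of f] T[of f'] unique[of f "?R f" f'] by metis
      qed
      show "?R ` ?D = ell2 m"
      proof
        show "?R ` ?D \<subseteq> ell2 m" using Rl2 by (auto simp: ell2_eq)
        show "ell2 m \<subseteq> ?R ` ?D"
        proof
          fix g assume "g \<in> ell2 m"
          then obtain f where f: "has_laplacian f (\<lambda>x. \<mu> * f x + g x)" using C by (auto simp: ell2_eq)
          then have "f \<in> ?D" using laplacian_iff by blast
          with R[OF f] show "g \<in> ?R ` ?D" by blast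
        qed
      qed
    qed
    moreover have "\<forall>f\<in>?D. ell2_norm m f \<le> sqrt C * ell2_norm m (?R f)"
    proof
      fix f assume f: "f \<in> ?D"
      obtain f' where f': "has_laplacian f' (\<lambda>x. \<mu> * f' x + ?R f x)" "wip m f' f' \<le> C * wip m (?R f) (?R f)"
        using bspec[OF C Rl2[OF f]] by blast
      have "wip m f f \<le> C * wip m (?R f) (?R f)"
        using unique[OF T[OF f] f'(1)] f'(2) by simp
      from real_sqrt_le_mono[OF this] show "ell2_norm m f \<le> sqrt C * ell2_norm m (?R f)"
        by (simp add: ell2_norm_def ell2_inner_eq real_sqrt_mult)
    qed
    ultimately have "\<mu> \<in> resolvent_set m ?D ?T" unfolding resolvent_set_def by blast
    with assms show False by (simp add: spectrum_def)
  qed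
  then obtain f where f: "has_laplacian f (\<lambda>x. \<mu> * f x)" "f \<noteq> (\<lambda>x. 0)" by blast
  then have pos: "wip m f f > 0"
    using wip_self_eq_0[of f] form_dom_ell2[of f] by (force simp: has_laplacian_def)
  define c where "c = 1 / sqrt (wip m f f)"
  show ?thesis
  proof (rule that)
    show "has_laplacian (\<lambda>x. c * f x) (\<lambda>x. \<mu> * (c * f x))"
      using has_laplacian_scale[OF f(1), of c] by (simp add: mult.left_commute)
    show "wip m (\<lambda>x. c * f x) (\<lambda>x. c * f x) = 1"
      unfolding vtx.wip_scale_left vtx.wip_scale_right using pos by (simp add: c_def)
  qed
qed

text \<open>
  An eigenvector satisfies \<open>Q(f, f) = \<mu> \<parallel>f\<parallel>\<^sup>2\<close>. If it vanishes on the finite set that tightness supplies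
  for an \<open>\<epsilon>\<close> with \<open>\<epsilon> * \<mu> \<le> 1 / 2\<close>, then \<open>\<parallel>f\<parallel>\<^sup>2 \<le> \<parallel>f\<parallel>\<^sup>2 / 2\<close>, and \<open>f = 0\<close>.
\<close>

lemma finite_dim_eigenspace: "finite_dim (eigenspace (laplacian_dom b m) (laplacian b m) \<mu>)"
proof -
  let ?\<epsilon> = "1 / (2 * (\<bar>\<mu>\<bar> + 1))"
  have pos: "?\<epsilon> > 0" by (simp add: add_nonneg_pos)
  obtain F where F: "finite F" "\<And>f. f \<in> form_dom b m \<Longrightarrow> wip m f f \<le> (\<Sum>x\<in>F. m x * (f x)\<^sup>2) + ?\<epsilon> * energy b f f"
    using tight[OF pos] by blast
  show ?thesis
  proof (rule finite_dim_if_determined_on_finite[OF F(1)])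
    fix f g c
    assume "f \<in> eigenspace (laplacian_dom b m) (laplacian b m) \<mu>" "g \<in> eigenspace (laplacian_dom b m) (laplacian b m) \<mu>"
    then have "has_laplacian (\<lambda>x. f x - c * g x) (\<lambda>x. \<mu> * f x - c * (\<mu> * g x))"
      unfolding eigenspace_iff by (intro has_laplacian_diff has_laplacian_scale)
    then show "(\<lambda>x. f x - c * g x) \<in> eigenspace (laplacian_dom b m) (laplacian b m) \<mu>"
      by (simp add: eigenspace_iff right_diff_distrib mult.left_commute)
  next
    fix f assume f: "f \<in> eigenspace (laplacian_dom b m) (laplacian b m) \<mu>" "\<forall>x\<in>F. f x = 0"
    then have fD: "f \<in> form_dom b m" and e: "energy b f f = \<mu> * wip m f f"
      by (auto simp: eigenspace_iff has_laplacian_def vtx.wip_scale_left)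
    have "wip m f f \<le> ?\<epsilon> * (\<mu> * wip m f f)" using F(2)[OF fD] f(2) e by simp
    also have "\<dots> = (?\<epsilon> * \<mu>) * wip m f f" by simp
    also have "\<dots> \<le> 1 / 2 * wip m f f"
      by (intro mult_right_mono vtx.wip_self_nonneg) (simp add: field_simps)
    finally show "f = (\<lambda>x. 0)" using form_dom_ell2[OF fD] by (intro wip_self_eq_0) auto
  qed
qed

text \<open>
  Eigenvectors for distinct eigenvalues are orthogonal, which is incompatible with norm convergence
  of eigenvectors for \<open>\<nu>\<^sub>k \<rightarrow> \<mu>\<close> to an eigenvector for \<open>\<mu>\<close>.
\<close>

lemma spectrum_isolated:
  assumes \<mu>: "\<mu> \<in> spectrum m (laplacian_dom b m) (laplacian b m)"
  shows "\<mu> isolated_in spectrum m (laplacian_dom b m) (laplacian b m)"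
proof (rule ccontr)
  assume "\<not> ?thesis"
  then have "\<exists>\<nu>. \<nu> \<in> spectrum m (laplacian_dom b m) (laplacian b m) \<and> dist \<mu> \<nu> < inverse (real (Suc k)) \<and> \<nu> \<noteq> \<mu>" for k
    using \<mu> unfolding isolated_in_dist_Ex_iff by (metis inverse_positive_iff_positive of_nat_0_less_iff zero_less_Suc)
  then obtain \<nu> where \<nu>: "\<And>k. \<nu> k \<in> spectrum m (laplacian_dom b m) (laplacian b m)"
    "\<And>k. dist \<mu> (\<nu> k) < inverse (real (Suc k))" "\<And>k. \<nu> k \<noteq> \<mu>" by metis
  have "\<exists>f. has_laplacian f (\<lambda>x. \<nu> k * f x) \<and> wip m f f = 1" for k
    using spectrum_eigenvalue[OF \<nu>(1)] by metis
  then obtain f where f: "\<And>k. has_laplacian (f k) (\<lambda>x. \<nu> k * f k x)" "\<And>k. wip m (f k) (f k) = 1" by metis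
  have fD: "f k \<in> form_dom b m" and fe: "h \<in> form_dom b m \<Longrightarrow> energy b (f k) h = \<nu> k * wip m (f k) h" for k h
    using f(1)[of k] by (auto simp: has_laplacian_def vtx.wip_scale_left)
  \<comment> \<open>An eigenvector for \<open>\<nu> k\<close> solves the equation for \<open>\<mu>\<close> up to a small error.\<close>
  let ?g = "\<lambda>k x. (\<nu> k - \<mu>) * f k x"
  have fe': "energy b (f k) h = \<mu> * wip m (f k) h + wip m (?g k) h" if "h \<in> form_dom b m" for k h
    unfolding fe[OF that] vtx.wip_scale_left by (simp add: left_diff_distrib)
  have le: "dist (\<nu> k) \<mu> \<le> inverse (real (Suc k))" for k
    using less_imp_le[OF \<nu>(2)[of k]] by (simp only: dist_commute)
  have lim_\<nu>: "\<nu> \<longlonglongrightarrow> \<mu>"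
    unfolding tendsto_dist_iff[of \<nu>]
    by (rule tendsto_sandwich[OF _ _ tendsto_const LIMSEQ_inverse_real_of_nat])
       (intro always_eventually allI le zero_le_dist)+
  have "(\<lambda>k. (\<nu> k - \<mu>) * (\<nu> k - \<mu>)) \<longlonglongrightarrow> (\<mu> - \<mu>) * (\<mu> - \<mu>)"
    by (intro tendsto_intros lim_\<nu>)
  moreover have "wip m (\<lambda>x. ?g k x - 0) (\<lambda>x. ?g k x - 0) = (\<nu> k - \<mu>) * (\<nu> k - \<mu>)" for k
    unfolding diff_zero vtx.wip_scale_left vtx.wip_scale_right f(2) by simp
  ultimately have g0: "(\<lambda>k. wip m (\<lambda>x. ?g k x - 0) (\<lambda>x. ?g k x - 0)) \<longlonglongrightarrow> 0" by simp
  obtain s f' where s: "strict_mono (s :: nat \<Rightarrow> nat)" and f': "has_laplacian f' (\<lambda>x. \<mu> * f' x + 0)"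
    and lim_h: "\<And>h. h \<in> wl2 m \<Longrightarrow> (\<lambda>k. wip m (f (s k)) h) \<longlonglongrightarrow> wip m f' h"
    and lim: "(\<lambda>k. wip m (f (s k)) (f (s k))) \<longlonglongrightarrow> wip m f' f'"
  proof (rule has_laplacian_subsequence[where f = f and g = ?g and g' = "\<lambda>x. 0" and \<mu> = \<mu> and K = 1])
    show "?g k \<in> wl2 m" for k using fD form_dom_ell2 vtx.wl2_scale by blast
    show "(\<lambda>x. 0) \<in> wl2 m" by (simp add: wl2_def)
    show "wip m (f k) (f k) \<le> 1" for k using f(2) by simp
    show "\<forall>\<^sub>F k in sequentially. energy b (f k) h = \<mu> * wip m (f k) h + wip m (?g k) h"
      if "h \<in> fin_supp \<union> range f" for h
      using that fD fin_supp_form_dom by (intro always_eventually allI fe') auto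
  qed (use fD fe' g0 in blast)+
  have f'D: "f' \<in> form_dom b m" and f'e: "h \<in> form_dom b m \<Longrightarrow> energy b f' h = \<mu> * wip m f' h" for h
    using f' by (auto simp: has_laplacian_def vtx.wip_scale_left)
  have orth: "wip m (f k) f' = 0" for k
    using fe[OF f'D, of k] f'e[OF fD, of k] \<nu>(3)[of k]
    by (simp add: energy_commute[of f'] wip_commute[of m f'])
  have "wip m f' f' = 0"
    using LIMSEQ_unique[OF lim_h[OF form_dom_ell2[OF f'D]], of 0] by (simp add: orth)
  moreover have "wip m f' f' = 1"
    using LIMSEQ_unique[OF lim, of 1] by (simp add: f(2))
  ultimately show False by simp
qed

theorem spectrum_discrete:
  "spectrum m (laplacian_dom b m) (laplacian b m) = discrete_spectrum m (laplacian_dom b m) (laplacian b m)"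
proof
  show "spectrum m (laplacian_dom b m) (laplacian b m) \<subseteq> discrete_spectrum m (laplacian_dom b m) (laplacian b m)"
  proof
    fix \<mu> assume \<mu>: "\<mu> \<in> spectrum m (laplacian_dom b m) (laplacian b m)"
    obtain f where f: "has_laplacian f (\<lambda>x. \<mu> * f x)" "wip m f f = 1" using spectrum_eigenvalue[OF \<mu>] .
    then have "f \<noteq> (\<lambda>x. 0)" by (auto simp: wip_def)
    then show "\<mu> \<in> discrete_spectrum m (laplacian_dom b m) (laplacian b m)"
      using f(1) spectrum_isolated[OF \<mu>] finite_dim_eigenspace
      unfolding discrete_spectrum_def by (auto simp: eigenspace_iff)
  qed
qed (auto simp: discrete_spectrum_def isolated_in_def)

theorem spectral_bottom_ge:
  assumes poincare: "\<And>f. f \<in> form_dom b m \<Longrightarrow> c * wip m f f \<le> energy b f f"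
  shows "spectral_bottom m (laplacian_dom b m) (laplacian b m) \<ge> ereal c"
  unfolding spectral_bottom_def
proof (rule INF_greatest)
  fix \<mu> assume "\<mu> \<in> spectrum m (laplacian_dom b m) (laplacian b m)"
  then obtain f where f: "has_laplacian f (\<lambda>x. \<mu> * f x)" "wip m f f = 1" by (rule spectrum_eigenvalue)
  then have "f \<in> form_dom b m" "energy b f f = \<mu>" by (auto simp: has_laplacian_def vtx.wip_scale_left)
  then show "ereal c \<le> ereal \<mu>" using poincare[of f] f(2) by simp
qed

end

section \<open>A Hardy inequality\<close>

text \<open>
  This is a discrete form of Picone's inequality; the defect is the square
  \<open>(q * s - p * t)\<^sup>2 / (p * q)\<close>.
\<close>

lemma picone_inequality:
  fixes p q s t :: real
  assumes "p > 0" "q > 0"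
  shows "(p - q) * (s\<^sup>2 / p - t\<^sup>2 / q) \<le> (s - t)\<^sup>2"
proof -
  have "(s - t)\<^sup>2 - (p - q) * (s\<^sup>2 / p - t\<^sup>2 / q) = (q * s - p * t)\<^sup>2 / (p * q)"
    using assms by (simp add: field_simps power2_eq_square)
  also have "\<dots> \<ge> 0" using assms by simp
  finally show ?thesis by simp
qed

context weighted_graph
begin

text \<open>
  Green's formula applied to the pair \<open>v\<close> and \<open>\<phi>\<^sup>2 / v\<close> turns the left-hand side into an energy, to
  which Picone's inequality applies edge by edge.
\<close>

lemma hardy_inequality_fin_supp:
  assumes v: "\<And>x. v x > 0" and F: "finite F" and \<phi>: "\<And>x. x \<notin> F \<Longrightarrow> \<phi> x = 0"
  shows "(\<Sum>x\<in>F. (\<phi> x)\<^sup>2 / v x * (\<Sum>y\<in>nbrs x. b x y * (v x - v y))) \<le> energy b \<phi> \<phi>"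
proof -
  define \<psi> where "\<psi> x = (\<phi> x)\<^sup>2 / v x" for x
  define S where "S = F \<union> (\<Union>x\<in>F. nbrs x)"
  have S: "finite S" using F finite_nbrs by (auto simp: S_def)
  have supp: "x \<in> S" "nbrs x \<subseteq> S" if "\<phi> x \<noteq> 0 \<or> \<psi> x \<noteq> 0" for x
    using that \<phi>[of x] by (auto simp: S_def \<psi>_def)
  have "(\<Sum>x\<in>F. \<psi> x * (\<Sum>y\<in>nbrs x. b x y * (v x - v y))) = energy b v \<psi>"
    by (rule green_formula[symmetric, OF F]) (simp add: \<psi>_def \<phi>)
  also have "\<dots> = 1 / 2 * (\<Sum>x\<in>S. \<Sum>y\<in>S. b x y * (v x - v y) * (\<psi> x - \<psi> y))"
    by (rule energy_eq_finite_sum[OF S]) (use supp in auto)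
  also have "\<dots> \<le> 1 / 2 * (\<Sum>x\<in>S. \<Sum>y\<in>S. b x y * (\<phi> x - \<phi> y) * (\<phi> x - \<phi> y))"
    unfolding mult.assoc \<psi>_def power2_eq_square[symmetric]
    by (intro mult_left_mono sum_mono picone_inequality v b_nonneg) simp
  also have "\<dots> = energy b \<phi> \<phi>"
    by (rule energy_eq_finite_sum[symmetric, OF S]) (use supp in auto)
  finally show ?thesis by (simp add: \<psi>_def)
qed

text \<open>
  Off \<open>F\<close> the Hardy weight \<open>1 / v\<close> is at least \<open>1 / \<epsilon>\<close>. All three terms of the inequality are
  continuous in the form norm, so it extends from finitely supported functions to the form domain.
\<close>

lemma hardy_inequality:
  assumes v: "\<And>x. v x > 0" and Lv: "\<And>x. (\<Sum>y\<in>nbrs x. b x y * (v x - v y)) = m x"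
    and F: "finite F" and small: "\<And>x. x \<notin> F \<Longrightarrow> v x \<le> \<epsilon>" and f: "f \<in> form_dom b m"
  shows "wip m f f \<le> (\<Sum>x\<in>F. m x * (f x)\<^sup>2) + \<epsilon> * energy b f f"
proof -
  have fin: "wip m \<phi> \<phi> \<le> (\<Sum>x\<in>F. m x * (\<phi> x)\<^sup>2) + \<epsilon> * energy b \<phi> \<phi>" if \<phi>: "\<phi> \<in> fin_supp" for \<phi>
  proof -
    define G where "G = F \<union> {x. \<phi> x \<noteq> 0}"
    have G: "finite G" "F \<subseteq> G" "\<And>x. x \<notin> G \<Longrightarrow> \<phi> x = 0" using F \<phi> by (auto simp: G_def fin_supp_def)
    obtain x where "x \<notin> F" using ex_new_if_finite[OF infinite_vertices F] by blast
    then have \<epsilon>: "\<epsilon> > 0" using v[of x] small[of x] by simp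
    have "(\<Sum>x\<in>G - F. m x * (\<phi> x)\<^sup>2) \<le> (\<Sum>x\<in>G - F. \<epsilon> * ((\<phi> x)\<^sup>2 / v x * m x))"
    proof (rule sum_mono)
      fix x assume "x \<in> G - F"
      then have "1 \<le> \<epsilon> / v x" using small[of x] v[of x] by simp
      then have "1 * (m x * (\<phi> x)\<^sup>2) \<le> \<epsilon> / v x * (m x * (\<phi> x)\<^sup>2)"
        by (rule mult_right_mono) (simp add: m_pos less_imp_le)
      then show "m x * (\<phi> x)\<^sup>2 \<le> \<epsilon> * ((\<phi> x)\<^sup>2 / v x * m x)" by (simp add: mult.commute mult.left_commute)
    qed
    also have "\<dots> \<le> (\<Sum>x\<in>G. \<epsilon> * ((\<phi> x)\<^sup>2 / v x * m x))"
      using G(1) \<epsilon> v m_pos by (intro sum_mono2) (auto simp: less_imp_le)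
    also have "\<dots> \<le> \<epsilon> * energy b \<phi> \<phi>"
      unfolding sum_distrib_left[symmetric]
      using hardy_inequality_fin_supp[of v G \<phi>, OF v G(1) G(3)] \<epsilon>
      by (intro mult_left_mono) (simp_all add: Lv)
    finally have "(\<Sum>x\<in>G - F. m x * (\<phi> x)\<^sup>2) \<le> \<epsilon> * energy b \<phi> \<phi>" .
    moreover have "wip m \<phi> \<phi> = (\<Sum>x\<in>G. m x * (\<phi> x)\<^sup>2)"
      using wip_fin_supp[of G \<phi> \<phi>] G by (simp add: power2_eq_square mult.assoc)
    moreover have "\<dots> = (\<Sum>x\<in>G - F. m x * (\<phi> x)\<^sup>2) + (\<Sum>x\<in>F. m x * (\<phi> x)\<^sup>2)"
      by (rule sum.subset_diff[OF G(2,1)])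
    ultimately show ?thesis by simp
  qed
  obtain \<phi> where \<phi>: "\<And>n. \<phi> n \<in> fin_supp" "(\<lambda>n. wip m (\<lambda>x. \<phi> n x - f x) (\<lambda>x. \<phi> n x - f x)) \<longlonglongrightarrow> 0"
    "(\<lambda>n. energy b (\<lambda>x. \<phi> n x - f x) (\<lambda>x. \<phi> n x - f x)) \<longlonglongrightarrow> 0" using form_dom_approx[OF f] by blast
  note \<phi>D = \<phi>(1)[THEN fin_supp_form_dom]
  have l2: "(\<lambda>n. wip m (\<phi> n) (\<phi> n)) \<longlonglongrightarrow> wip m f f"
    by (rule vtx.wip_tendsto[where u = \<phi> and v = \<phi>, OF form_dom_ell2[OF \<phi>D] form_dom_ell2[OF f]
        form_dom_ell2[OF \<phi>D] form_dom_ell2[OF f] \<phi>(2) \<phi>(2)])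
  have en: "(\<lambda>n. energy b (\<phi> n) (\<phi> n)) \<longlonglongrightarrow> energy b f f"
    by (rule energy_tendsto[where u = \<phi> and v = \<phi>, OF \<phi>D f \<phi>D f \<phi>(3) \<phi>(3)])
  have point: "(\<lambda>n. \<phi> n x) \<longlonglongrightarrow> f x" for x
  proof (rule LIM_zero_cancel, rule tendsto_rabs_zero_cancel)
    have "m x * (\<phi> n x - f x)\<^sup>2 \<le> wip m (\<lambda>x. \<phi> n x - f x) (\<lambda>x. \<phi> n x - f x)" for n
      using vtx.finite_sum_le_wip[of "\<lambda>x. \<phi> n x - f x" "{x}"] form_dom_ell2[OF form_dom_diff[OF \<phi>D f]] by simp
    then have "(\<phi> n x - f x)\<^sup>2 \<le> wip m (\<lambda>x. \<phi> n x - f x) (\<lambda>x. \<phi> n x - f x) / m x" for n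
      using m_pos[of x] by (simp add: field_simps)
    then have "(\<lambda>n. (\<phi> n x - f x)\<^sup>2) \<longlonglongrightarrow> 0"
      by (intro tendsto_sandwich[OF _ _ tendsto_const tendsto_divide_zero[OF \<phi>(2), of "m x"]]) auto
    from tendsto_real_sqrt[OF this] show "(\<lambda>n. \<bar>\<phi> n x - f x\<bar>) \<longlonglongrightarrow> 0" by simp
  qed
  show ?thesis
  proof (rule tendsto_le[OF sequentially_bot _ l2])
    show "(\<lambda>n. (\<Sum>x\<in>F. m x * (\<phi> n x)\<^sup>2) + \<epsilon> * energy b (\<phi> n) (\<phi> n)) \<longlonglongrightarrow> (\<Sum>x\<in>F. m x * (f x)\<^sup>2) + \<epsilon> * energy b f f"
      by (intro tendsto_intros point en)
  qed (simp add: fin[OF \<phi>(1)])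
qed

end

section \<open>The potential of the weakly spherically symmetric graph\<close>

context weakly_spherically_symmetric_graph
begin

abbreviation depth :: "'v \<Rightarrow> nat" where "depth x \<equiv> gdist b x x0"
abbreviation layer :: "int \<Rightarrow> 'v set" where "layer \<equiv> sphere_at b x0"

lemma depth_nbr_le: "y \<in> nbrs x \<Longrightarrow> depth x \<le> Suc (depth y)"
  using gdist_path[of y x0] by (auto simp: nbrs_def intro!: gdist_le relpow_Suc_I2)

lemma nbrs_sym: "y \<in> nbrs x \<longleftrightarrow> x \<in> nbrs y"
  using edges_sym by (simp add: nbrs_def)

text \<open>
  Neighbours in the same sphere do not contribute. At the root \<open>depth x - 1\<close> is again 0, which makes the
  inward term vanish, in accordance with the empty sphere of radius \<open>-1\<close>.
\<close>

lemma laplacian_radial: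
  "(\<Sum>y\<in>nbrs x. b x y * (R (depth x) - R (depth y)))
    = m x * (kappa_plus b m x0 x * (R (depth x) - R (Suc (depth x)))
       - kappa_minus b m x0 x * (R (depth x - 1) - R (depth x)))"
proof -
  let ?r = "int (depth x)"
  let ?U = "layer (?r + 1) \<union> layer (?r - 1)"
  let ?g = "\<lambda>y. b x y * (R (depth x) - R (depth y))"
  have g0: "?g y = 0" if "y \<in> nbrs x" "y \<notin> ?U" for y
  proof -
    have "depth y = depth x"
      using depth_nbr_le[OF that(1)] depth_nbr_le[of x y] that nbrs_sym[of y x] by (auto simp: sphere_at_def)
    then show ?thesis by simp
  qed
  have "(\<Sum>y\<in>nbrs x. ?g y) = (\<Sum>y\<in>nbrs x \<union> ?U. ?g y)"
    by (rule sum.mono_neutral_left) (auto simp: finite_nbrs finite_sphere_at b_eq_0_off_nbrs)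
  also have "\<dots> = (\<Sum>y\<in>?U. ?g y)"
    using finite_nbrs finite_sphere_at by (intro sum.mono_neutral_right) (use g0 in auto)
  also have "\<dots> = (\<Sum>y\<in>layer (?r + 1). ?g y) + (\<Sum>y\<in>layer (?r - 1). ?g y)"
    by (rule sum.union_disjoint[OF finite_sphere_at finite_sphere_at]) (auto simp: sphere_at_def)
  also have "(\<Sum>y\<in>layer (?r + 1). ?g y) = (\<Sum>y\<in>layer (?r + 1). b x y * (R (depth x) - R (Suc (depth x))))"
  proof (rule sum.cong)
    fix y assume "y \<in> layer (?r + 1)"
    then have "depth y = Suc (depth x)" by (simp add: sphere_at_def)
    then show "?g y = b x y * (R (depth x) - R (Suc (depth x)))" by simp
  qed simp
  also have "(\<Sum>y\<in>layer (?r - 1). ?g y) = (\<Sum>y\<in>layer (?r - 1). b x y * - (R (depth x - 1) - R (depth x)))"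
  proof (rule sum.cong)
    fix y assume "y \<in> layer (?r - 1)"
    then have "depth y = depth x - 1" by (simp add: sphere_at_def)
    then show "?g y = b x y * - (R (depth x - 1) - R (depth x))" by simp
  qed simp
  finally have "(\<Sum>y\<in>nbrs x. ?g y) = (\<Sum>y\<in>layer (?r + 1). b x y) * (R (depth x) - R (Suc (depth x)))
      - (\<Sum>y\<in>layer (?r - 1). b x y) * (R (depth x - 1) - R (depth x))"
    by (simp only: sum_distrib_right[symmetric] mult_minus_right sum_negf add_uminus_conv_diff)
  moreover have "(\<Sum>y\<in>layer (?r + 1). b x y) = m x * kappa_plus b m x0 x"
    "(\<Sum>y\<in>layer (?r - 1). b x y) = m x * kappa_minus b m x0 x"
    using m_pos[of x] by (simp_all add: kappa_plus_def kappa_minus_def)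
  ultimately show ?thesis by (simp only: right_diff_distrib mult.assoc)
qed

lemma kappa_plus_total: "kappa_plus b m x0 x * (\<Sum>y\<in>layer (int (depth x)). m y) = boundary b m x0 (depth x)"
  unfolding boundary_def sum_distrib_left
  by (intro sum.cong refl arg_cong2[where f = "(*)"] kappa_plus_radial) (auto simp: sphere_at_def)

text \<open>
  Edges between consecutive spheres are counted from their outer ends here and from their inner ends in \<open>\<partial>B(r)\<close>.
\<close>

lemma kappa_minus_total:
  assumes "depth x = Suc r"
  shows "kappa_minus b m x0 x * (\<Sum>y\<in>layer (int (Suc r)). m y) = boundary b m x0 r"
proof -
  have m0: "m y \<noteq> 0" for y using m_pos[of y] by simp
  have "kappa_minus b m x0 x * (\<Sum>y\<in>layer (int (Suc r)). m y) = (\<Sum>y\<in>layer (int (Suc r)). kappa_minus b m x0 y * m y)"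
    unfolding sum_distrib_left using assms
    by (intro sum.cong refl arg_cong2[where f = "(*)"] kappa_minus_radial) (auto simp: sphere_at_def)
  also have "\<dots> = (\<Sum>y\<in>layer (int (Suc r)). \<Sum>z\<in>layer (int r). b y z)"
    by (intro sum.cong refl) (auto simp: kappa_minus_def sphere_at_def m0)
  also have "\<dots> = (\<Sum>z\<in>layer (int r). \<Sum>y\<in>layer (int (Suc r)). b z y)"
    by (subst sum.swap) (simp add: b_sym)
  also have "\<dots> = boundary b m x0 r"
    unfolding boundary_def
    by (intro sum.cong refl) (auto simp: kappa_plus_def sphere_at_def m0 add.commute)
  finally show ?thesis .
qed

lemma volume1_Suc: "volume1 b m x0 (Suc r) = volume1 b m x0 r + (\<Sum>y\<in>layer (int (Suc r)). m y)"
proof -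
  have "ball_at b x0 (Suc r) = ball_at b x0 r \<union> layer (int (Suc r))"
    by (auto simp: ball_at_def atMost_Suc)
  moreover have "ball_at b x0 r \<inter> layer (int (Suc r)) = {}" by (auto simp: ball_at_def sphere_at_def)
  moreover have "finite (ball_at b x0 r)" by (auto simp: ball_at_def finite_sphere_at)
  ultimately show ?thesis
    unfolding volume1_def by (simp add: sum.union_disjoint finite_sphere_at)
qed

lemma volume1_pos: "volume1 b m x0 r > 0"
  unfolding volume1_def
proof (rule sum_pos)
  show "finite (ball_at b x0 r)" by (auto simp: ball_at_def finite_sphere_at)
  show "ball_at b x0 r \<noteq> {}" using sphere_at_nonempty[of x0 r] by (auto simp: ball_at_def)
qed (rule m_pos)

text \<open>
  For radial functions the decrements \<open>V\<^sub>1(r) / \<partial>B(r)\<close> are forced by the equation \<open>L v = 1\<close>: by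
  summation over a ball the flux through its boundary equals its measure.
\<close>

lemma flux_balance:
  assumes R: "\<And>r. R r - R (Suc r) = volume1 b m x0 r / boundary b m x0 r"
  shows "(\<Sum>y\<in>nbrs x. b x y * (R (depth x) - R (depth y))) = m x"
proof -
  let ?M = "\<Sum>y\<in>layer (int (depth x)). m y"
  have M: "?M > 0" by (rule sum_pos[OF finite_sphere_at sphere_at_nonempty m_pos])
  have bp: "boundary b m x0 r * (R r - R (Suc r)) = volume1 b m x0 r" for r
    unfolding R using boundary_pos[of x0 r] by simp
  have p: "?M * (kappa_plus b m x0 x * (R (depth x) - R (Suc (depth x)))) = volume1 b m x0 (depth x)"
    using bp[of "depth x"] kappa_plus_total[of x] by (simp add: mult.assoc[symmetric] mult.commute)
  have "?M * (kappa_plus b m x0 x * (R (depth x) - R (Suc (depth x)))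
      - kappa_minus b m x0 x * (R (depth x - 1) - R (depth x))) = ?M"
  proof (cases "depth x")
    case 0
    have "volume1 b m x0 0 = ?M" by (simp add: volume1_def ball_at_def 0)
    moreover have "kappa_minus b m x0 x * (R (depth x - 1) - R (depth x)) = 0" by (simp add: 0)
    ultimately show ?thesis using p 0 by simp
  next
    case (Suc r)
    have "?M * (kappa_minus b m x0 x * (R r - R (Suc r))) = volume1 b m x0 r"
      using bp[of r] kappa_minus_total[OF Suc] by (simp add: Suc mult.assoc[symmetric] mult.commute)
    then show ?thesis using p volume1_Suc[of r] by (simp add: Suc right_diff_distrib)
  qed
  then show ?thesis using M by (simp add: laplacian_radial)
qed

end

theorem theorem3:
  fixes b :: "'v \<Rightarrow> 'v \<Rightarrow> real" and m :: "'v \<Rightarrow> real" and x0 :: 'v and a :: real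
  assumes "weakly_spherically_symmetric_graph b m x0"
    and "(\<lambda>r. volume1 b m x0 r / boundary b m x0 r) sums a"
  shows "spectral_bottom m (laplacian_dom b m) (laplacian b m) \<ge> ereal (1 / a) \<and>
    spectrum m (laplacian_dom b m) (laplacian b m)
      = discrete_spectrum m (laplacian_dom b m) (laplacian b m)"
proof -
  interpret weakly_spherically_symmetric_graph b m x0 by fact
  define t where "t r = volume1 b m x0 r / boundary b m x0 r" for r
  have t_pos: "t r > 0" for r unfolding t_def using volume1_pos boundary_pos[of x0] by simp
  have t_sums: "t sums a" using assms(2) by (simp add: t_def[abs_def])
  \<comment> \<open>the tail of the series from index \<open>r\<close> on\<close>
  define R where "R r = a - (\<Sum>k<r. t k)" for r
  have R_step: "R r - R (Suc r) = volume1 b m x0 r / boundary b m x0 r" for r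
    by (simp add: R_def t_def)
  have R_lim: "R \<longlonglongrightarrow> 0"
    using tendsto_diff[OF tendsto_const t_sums[unfolded sums_def], of a] by (simp add: R_def[abs_def])
  have R_anti: "decseq R" using t_pos by (intro decseq_SucI) (simp add: R_def less_imp_le)
  have R_pos: "R r > 0" for r
  proof -
    have "R (Suc r) \<ge> 0" using decseq_ge[OF R_anti R_lim] .
    then show ?thesis using t_pos[of r] by (simp add: R_def)
  qed
  define v where "v x = R (depth x)" for x
  have v_pos: "v x > 0" for x by (simp add: v_def R_pos)
  have Lv: "(\<Sum>y\<in>nbrs x. b x y * (v x - v y)) = m x" for x
    unfolding v_def using R_step by (rule flux_balance)
  note hardy = hardy_inequality[of v, OF v_pos Lv]
  interpret tight_form b m
  proof unfold_locales
    fix \<epsilon> :: real assume "\<epsilon> > 0"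
    then obtain N where N: "R N < \<epsilon>"
      using order_tendstoD(2)[OF R_lim] eventually_happens'[OF sequentially_bot] by blast
    have "finite (ball_at b x0 N)" by (simp add: ball_at_def finite_sphere_at)
    moreover have "v x \<le> \<epsilon>" if "x \<notin> ball_at b x0 N" for x
    proof -
      have "N \<le> depth x" using that by (auto simp: ball_at_def sphere_at_def)
      then show ?thesis using decseqD[OF R_anti, of N "depth x"] N by (simp add: v_def)
    qed
    ultimately show "\<exists>F. finite F \<and> (\<forall>f\<in>form_dom b m.
        wip m f f \<le> (\<Sum>x\<in>F. m x * (f x)\<^sup>2) + \<epsilon> * energy b f f)"
      using hardy by blast
  qed
  have R0: "R 0 = a" by (simp add: R_def)
  have "1 / a * wip m f f \<le> energy b f f" if "f \<in> form_dom b m" for f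
  proof -
    have "v x \<le> a" for x using decseqD[OF R_anti, of 0 "depth x"] by (simp add: v_def R0)
    then have "wip m f f \<le> a * energy b f f" using hardy[of "{}" a f] that by simp
    then show ?thesis using R_pos[of 0] by (simp add: R0 field_simps)
  qed
  then show ?thesis using spectral_bottom_ge spectrum_discrete by blast
qed

end
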